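(* Let $K\subset\mathbb{R}^n$ be a proper cone and let $\mathcal{S}=\bigcup_t\mathcal{S}_t\subset\pi(K)$ be a $K$-irreducible semigroup generated in one of the three ways described in the context (in case (C) assume each $\mathcal{S}_t$ is bounded). Then there exists a norm $v$ on $\mathbb{R}^n$ which is monotone with respect to $K$ and extremal for $\mathcal{S}$. If $K$ is simplicial, then $v$ may be chosen to be absolute.
   Context: A proper cone $K\subset\mathbb{R}^n$ is a nonempty set with $rK\subset K$ for all $r>0$ which is convex, pointed, closed and has nonempty interior. Write $x\ge_K y$ if $x-y\in K$. A face of $K$ is a cone $F\subseteq K$ with: $x\in F$, $x\ge_K y\ge_K0$ imply $y\in F$; $\{0\},K$ are trivial. $\pi(K)=\{A: AK\subset K\}$; $A\in\pi(K)$ is $K$-irreducible if no nontrivial face $F$ has $AF\subset F$. Semigroups: (A) discrete: compact $\mathcal{M}$, $\mathcal{S}_0=\{I\}$, $\mathcal{S}_t=\{A_{t-1}\cdots A_0:A_s\in\mathcal{M}\}$. (B) continuous: compact $\mathcal{M}$, $\mathcal{S}_t=\{\Phi_\sigma(t)\}$ over measurable $\sigma:[0,t]\to\mathcal{M}$, $\dot\Phi_\sigma=\sigma\Phi_\sigma$, $\Phi_\sigma(0)=I$. (C) with jumps: compact set $\mathcal{M}$ of pairs $(A,\Pi)$ with $\Pi^2=\Pi$, $A\Pi=\Pi A$; for piecewise constant right-continuous $\sigma$ with switching times $0=t_0<t_1<\dots\to\infty$ and $t\in[t_k,t_{k+1})$, $\Phi_\sigma(t)=e^{A_{\sigma(t_k)}(t-t_k)}\Pi_{\sigma(t_k)}\cdots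 e^{A_{\sigma(t_0)}(t_1-t_0)}\Pi_{\sigma(t_0)}$, $\mathcal{S}_t$ the set of these. $\mathcal{S}=\bigcup_t\mathcal{S}_t$. Joint spectral radius $\rho(\mathcal{S})=\lim_{t\to\infty}\sup\{\|S\|:S\in\mathcal{S}_t\}^{1/t}$. $\mathcal{S}\subset\pi(K)$ is $K$-irreducible if for some $t>0$, $\operatorname{conv}\mathcal{S}_t$ contains a $K$-irreducible element. A norm $v$ is extremal for $\mathcal{S}$ if $v(Sx)\le\rho(\mathcal{S})^t v(x)$ for all $x\in\mathbb{R}^n$, all $t$, all $S\in\mathcal{S}_t$. A norm is monotone (w.r.t. $K$) if $x\ge_K y\ge_K0$ implies $\|x\|\ge\|y\|$. $K$ is simplicial if it is the conical hull of $n$ linearly independent vectors; then $|x|_K$ denotes the least upper bound of $x$ and $-x$ in the order $\ge_K$, and a norm is absolute if $\|x\|=\||x|_K\|$ for all $x$. *)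

theory Defs
  imports "HOL-Analysis.Analysis"
begin

type_synonym ('n) mat = "real^'n^'n"

section \<open>Cones, order, faces\<close>

definition is_cone :: "(real^'n::finite) set \<Rightarrow> bool" where
  "is_cone C \<longleftrightarrow> C \<noteq> {} \<and> (\<forall>r>0. \<forall>x\<in>C. r *\<^sub>R x \<in> C)"

definition proper_cone :: "(real^'n::finite) set \<Rightarrow> bool" where
  "proper_cone K \<longleftrightarrow> is_cone K \<and> convex K \<and> K \<inter> uminus ` K = {0}
     \<and> closed K \<and> interior K \<noteq> {}"

definition cone_ge :: "(real^'n::finite) set \<Rightarrow> real^'n \<Rightarrow> real^'n \<Rightarrow> bool" where
  "cone_ge K x y \<longleftrightarrow> x - y \<in> K"

text \<open>A face: a (convex) subcone F of K with x in F, x >=_K y >=_K 0 implying y in F.\<close>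
definition is_face :: "(real^'n::finite) set \<Rightarrow> (real^'n::finite) set \<Rightarrow> bool" where
  "is_face K F \<longleftrightarrow> is_cone F \<and> convex F \<and> F \<subseteq> K \<and>
     (\<forall>x y. x \<in> F \<and> cone_ge K x y \<and> cone_ge K y 0 \<longrightarrow> y \<in> F)"

definition nontrivial_face :: "(real^'n::finite) set \<Rightarrow> (real^'n::finite) set \<Rightarrow> bool" where
  "nontrivial_face K F \<longleftrightarrow> is_face K F \<and> F \<noteq> {0} \<and> F \<noteq> K"

definition pi_cone :: "(real^'n::finite) set \<Rightarrow> 'n::finite mat set" where
  "pi_cone K = {A. (\<lambda>x. A *v x) ` K \<subseteq> K}"

definition K_irreducible :: "(real^'n::finite) set \<Rightarrow> 'n::finite mat \<Rightarrow> bool" where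
  "K_irreducible K A \<longleftrightarrow> A \<in> pi_cone K \<and>
     \<not> (\<exists>F. nontrivial_face K F \<and> (\<lambda>x. A *v x) ` F \<subseteq> F)"

section \<open>Matrix exponential\<close>

primrec mat_pow :: "'n::finite mat \<Rightarrow> nat \<Rightarrow> 'n::finite mat" where
  "mat_pow A 0 = mat 1"
| "mat_pow A (Suc k) = A ** mat_pow A k"

definition mat_exp :: "'n::finite mat \<Rightarrow> 'n::finite mat" where
  "mat_exp A = (\<Sum>k. (1 / fact k) *\<^sub>R mat_pow A k)"

section \<open>The three kinds of semigroups\<close>

text \<open>(A) discrete: S_k = products of k elements of M.\<close>
definition disc_set :: "'n::finite mat set \<Rightarrow> nat \<Rightarrow> 'n::finite mat set" where
  "disc_set M k = {foldr (**) As (mat 1) | As. length As = k \<and> set As \<subseteq> M}"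

text \<open>(B) continuous: Phi is the (Caratheodory) solution of Phi' = sigma Phi, Phi(0) = I,
  written in integral form, for measurable sigma : [0,t] -> M.\<close>
definition cont_set :: "'n::finite mat set \<Rightarrow> real \<Rightarrow> 'n::finite mat set" where
  "cont_set M t = {\<Phi> t | \<sigma> \<Phi>. (\<forall>s\<in>{0..t}. \<sigma> s \<in> M) \<and> \<sigma> measurable_on {0..t} \<and>
      continuous_on {0..t} \<Phi> \<and>
      (\<forall>s\<in>{0..t}. ((\<lambda>r. \<sigma> r ** \<Phi> r) has_integral (\<Phi> s - mat 1)) {0..s})}"

text \<open>(C) with jumps. A piecewise constant right-continuous switching signal is given by
  switching times ts (ts 0 = 0, strictly increasing, tending to infinity) and the values
  p k = sigma(ts k) in M.  jump_pre ts p k is the product of the first k factors.\<close>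
primrec jump_pre :: "(nat \<Rightarrow> real) \<Rightarrow> (nat \<Rightarrow> 'n::finite mat \<times> 'n::finite mat) \<Rightarrow> nat \<Rightarrow> 'n::finite mat" where
  "jump_pre ts p 0 = mat 1"
| "jump_pre ts p (Suc k) =
     mat_exp ((ts (Suc k) - ts k) *\<^sub>R fst (p k)) ** snd (p k) ** jump_pre ts p k"

definition jump_set :: "('n::finite mat \<times> 'n::finite mat) set \<Rightarrow> real \<Rightarrow> 'n::finite mat set" where
  "jump_set M t = {mat_exp ((t - ts k) *\<^sub>R fst (p k)) ** snd (p k) ** jump_pre ts p k
      | ts p k. ts 0 = 0 \<and> strict_mono ts \<and> filterlim ts at_top sequentially \<and>
          (\<forall>j. p j \<in> M) \<and> ts k \<le> t \<and> t < ts (Suc k)}"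

text \<open>A semigroup is represented by its time domain T (naturals or [0,oo)) and the
  family S t, t in T.\<close>
definition generated_semigroup :: "real set \<Rightarrow> (real \<Rightarrow> 'n::finite mat set) \<Rightarrow> bool" where
  "generated_semigroup T S \<longleftrightarrow>
     (\<exists>M. compact M \<and> T = range real \<and> (\<forall>k::nat. S (real k) = disc_set M k))
   \<or> (\<exists>M. compact M \<and> T = {0..} \<and> (\<forall>t\<ge>0. S t = cont_set M t))
   \<or> (\<exists>M. compact M \<and> (\<forall>(A, P)\<in>M. P ** P = P \<and> A ** P = P ** A) \<and>
          T = {0..} \<and> (\<forall>t\<ge>0. S t = jump_set M t) \<and> (\<forall>t\<ge>0. bounded (S t)))"

definition jsr :: "real set \<Rightarrow> (real \<Rightarrow> 'n::finite mat set) \<Rightarrow> real" where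
  "jsr T S = Lim (inf at_top (principal T))
     (\<lambda>t. (SUP A\<in>S t. onorm (\<lambda>x. A *v x)) powr (1 / t))"

definition semigroup_K_irreducible :: "(real^'n::finite) set \<Rightarrow> real set \<Rightarrow> (real \<Rightarrow> 'n::finite mat set) \<Rightarrow> bool" where
  "semigroup_K_irreducible K T S \<longleftrightarrow> (\<exists>t\<in>T. t > 0 \<and> (\<exists>A\<in>convex hull (S t). K_irreducible K A))"

section \<open>Norms\<close>

definition is_norm :: "(real^'n::finite \<Rightarrow> real) \<Rightarrow> bool" where
  "is_norm v \<longleftrightarrow> (\<forall>x. v x \<ge> 0) \<and> (\<forall>x. v x = 0 \<longleftrightarrow> x = 0) \<and>
     (\<forall>c x. v (c *\<^sub>R x) = \<bar>c\<bar> * v x) \<and> (\<forall>x y. v (x + y) \<le> v x + v y)"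

text \<open>rho^t, with the convention rho^0 = 1.\<close>
definition rpow :: "real \<Rightarrow> real \<Rightarrow> real" where
  "rpow r t = (if t = 0 then 1 else r powr t)"

definition extremal_norm :: "real set \<Rightarrow> (real \<Rightarrow> 'n::finite mat set) \<Rightarrow> (real^'n::finite \<Rightarrow> real) \<Rightarrow> bool" where
  "extremal_norm T S v \<longleftrightarrow> is_norm v \<and>
     (\<forall>t\<in>T. \<forall>A\<in>S t. \<forall>x. v (A *v x) \<le> rpow (jsr T S) t * v x)"

definition monotone_norm :: "(real^'n::finite) set \<Rightarrow> (real^'n::finite \<Rightarrow> real) \<Rightarrow> bool" where
  "monotone_norm K v \<longleftrightarrow> (\<forall>x y. cone_ge K x y \<and> cone_ge K y 0 \<longrightarrow> v x \<ge> v y)"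

definition simplicial :: "(real^'n::finite) set \<Rightarrow> bool" where
  "simplicial K \<longleftrightarrow> (\<exists>b :: 'n \<Rightarrow> real^'n. inj b \<and> independent (range b) \<and>
      K = {(\<Sum>i\<in>UNIV. c i *\<^sub>R b i) | c. \<forall>i. c i \<ge> 0})"

text \<open>|x|_K: the least upper bound of x and -x w.r.t. >=_K.\<close>
definition abs_K :: "(real^'n::finite) set \<Rightarrow> real^'n \<Rightarrow> real^'n" where
  "abs_K K x = (THE z. cone_ge K z x \<and> cone_ge K z (- x) \<and>
      (\<forall>w. cone_ge K w x \<and> cone_ge K w (- x) \<longrightarrow> cone_ge K w z))"

definition absolute_norm :: "(real^'n::finite) set \<Rightarrow> (real^'n::finite \<Rightarrow> real) \<Rightarrow> bool" where
  "absolute_norm K v \<longleftrightarrow> (\<forall>x. v x = v (abs_K K x))"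

end

theory Submission
  imports Defs
begin

text \<open>
  Let \<open>A\<close> be an irreducible element of the convex hull of the time-\<open>t0\<close> set and let \<open>e\<close> be an
  interior point of the cone. For nonzero \<open>x\<close> in the cone, the vectors dominated by a multiple of some
  partial sum \<open>x + A x + \<dots> + A^N x\<close> form an \<open>A\<close>-invariant face, which is therefore the whole cone.
  By compactness one \<open>N\<close> and one multiple suffice to dominate \<open>\<parallel>x\<parallel> e\<close> for all \<open>x\<close>. Hence, up to a
  time delay of at most \<open>N t0\<close> and a constant factor, the growth function
  \<open>sup {\<parallel>X\<parallel> : X at time t}\<close> is supermultiplicative. It is also submultiplicative, so its rate
  \<open>\<rho>\<close> exists by Fekete's lemma. Were \<open>\<rho>^-t \<parallel>X\<parallel>\<close> unbounded, chaining copies of a large element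
  would produce a rate above \<open>\<rho>\<close>; the same argument shows that \<open>\<rho> = 0\<close> forces the semigroup to
  vanish at positive times. Thus \<open>v x = sup \<bar>g \<bullet> w x\<bar>\<close>, over functionals \<open>g\<close> in the unit ball of
  the dual cone and \<open>w = I\<close> or \<open>w = \<rho>^-t X\<close>, is finite; it is a monotone extremal norm. On a
  simplicial cone, \<open>v \<circ> \<bar>\<cdot>\<bar>\<close> is moreover absolute.

  Submultiplicativity needs each element at time \<open>s + t\<close> to factor through time \<open>t\<close>. For the
  differential equation this rests on the invertibility of the fundamental solution, and for
  jumps on \<open>\<Pi>\<close> being idempotent and commuting with its generator.
\<close>

section \<open>Matrices as operators\<close>

lemma bounded_bilinear_matrix_matrix_mult:
  "bounded_bilinear ((**) :: real^'n^'n \<Rightarrow> real^'n^'n \<Rightarrow> real^'n^'n)"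
proof -
  have "bilinear ((**) :: real^'n^'n \<Rightarrow> real^'n^'n \<Rightarrow> real^'n^'n)"
    unfolding bilinear_def
    by (auto intro!: linearI simp: matrix_add_ldistrib matrix_matrix_mult_def vec_eq_iff
        distrib_right distrib_left sum.distrib sum_distrib_left mult_ac)
  then show ?thesis
    by (simp add: bilinear_conv_bounded_bilinear)
qed

lemma bounded_bilinear_matrix_vector_mult:
  "bounded_bilinear ((*v) :: real^'n^'n \<Rightarrow> real^'n \<Rightarrow> real^'n)"
proof -
  have "bilinear ((*v) :: real^'n^'n \<Rightarrow> real^'n \<Rightarrow> real^'n)"
    unfolding bilinear_def
    by (auto intro!: linearI simp: algebra_simps matrix_vector_mult_def vec_eq_iff
        sum.distrib sum_distrib_left)
  then show ?thesis
    by (simp add: bilinear_conv_bounded_bilinear)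
qed

lemma matrix_mult_norm_bound:
  obtains C where "0 < C" "\<And>(A :: real^'n^'n) (X :: real^'n^'n). norm (A ** X) \<le> norm A * norm X * C"
proof -
  interpret bounded_bilinear "(**) :: real^'n^'n \<Rightarrow> real^'n^'n \<Rightarrow> real^'n^'n"
    by (rule bounded_bilinear_matrix_matrix_mult)
  show thesis using pos_bounded that by blast
qed

lemma bounded_linear_matrix_right:
  fixes Z :: "real^'n^'n" shows "bounded_linear (\<lambda>X :: real^'n^'n. X ** Z)"
  by (rule bounded_bilinear.bounded_linear_left[OF bounded_bilinear_matrix_matrix_mult])

lemma bounded_linear_matrix_left:
  fixes Z :: "real^'n^'n" shows "bounded_linear (\<lambda>X :: real^'n^'n. Z ** X)"
  by (rule bounded_bilinear.bounded_linear_right[OF bounded_bilinear_matrix_matrix_mult])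

lemmas matrix_mult_tendsto = bounded_bilinear.tendsto[OF bounded_bilinear_matrix_matrix_mult]
lemmas matrix_vector_tendsto = bounded_bilinear.tendsto[OF bounded_bilinear_matrix_vector_mult]
lemmas matrix_mult_scaleR =
  bounded_bilinear.scaleR_left[OF bounded_bilinear_matrix_matrix_mult]
  bounded_bilinear.scaleR_right[OF bounded_bilinear_matrix_matrix_mult]
lemmas scaleR_matrix_vector = bounded_bilinear.scaleR_left[OF bounded_bilinear_matrix_vector_mult]

abbreviation opnorm :: "real^'n^'n \<Rightarrow> real" where
  "opnorm A \<equiv> onorm (\<lambda>x. A *v x)"

lemma opnorm_nonneg: "0 \<le> opnorm A"
  by (simp add: onorm_pos_le)

lemma norm_matrix_vector_le: "norm (A *v x) \<le> opnorm A * norm x"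
  for A :: "real^'n^'n"
  by (simp add: onorm)

lemma opnorm_le: "(\<And>x. norm (A *v x) \<le> c * norm x) \<Longrightarrow> opnorm A \<le> c"
  for A :: "real^'n^'n"
  by (rule onorm_le) auto

lemma opnorm_mult: "opnorm (A ** B) \<le> opnorm A * opnorm B" for A :: "real^'n^'n"
  using onorm_compose[of "(*v) A" "(*v) B"] by (simp add: o_def matrix_vector_mul_assoc)

lemma opnorm_le_norm:
  obtains C where "0 < C" "\<And>A :: real^'n^'n. opnorm A \<le> C * norm A"
proof -
  interpret bounded_bilinear "(*v) :: real^'n^'n \<Rightarrow> real^'n \<Rightarrow> real^'n"
    by (rule bounded_bilinear_matrix_vector_mult)
  obtain C where C: "C > 0" "\<And>A x. norm (A *v x) \<le> norm (A::real^'n^'n) * norm x * C"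
    using pos_bounded by blast
  have "opnorm A \<le> C * norm A" for A :: "real^'n^'n"
    by (rule opnorm_le) (use C(2)[of A] in \<open>simp add: mult_ac\<close>)
  with C(1) show thesis by (rule that)
qed

lemma opnorm_le_closure:
  fixes D :: "(real^'n^'n) set"
  assumes "\<And>A. A \<in> D \<Longrightarrow> opnorm A \<le> c" and "A \<in> closure D"
  shows "opnorm A \<le> c"
proof -
  obtain X where X: "\<And>n. X n \<in> D" "X \<longlonglongrightarrow> A"
    using assms(2) closure_sequential by blast
  show ?thesis
  proof (rule opnorm_le)
    fix x
    have "(\<lambda>n. norm (X n *v x)) \<longlonglongrightarrow> norm (A *v x)"
      by (intro tendsto_norm matrix_vector_tendsto X tendsto_const)
    moreover have "norm (X n *v x) \<le> c * norm x" for n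
      using norm_matrix_vector_le[of "X n" x] assms(1)[OF X(1), of n]
      by (meson mult_right_mono norm_ge_zero order_trans)
    ultimately show "norm (A *v x) \<le> c * norm x"
      by (intro LIMSEQ_le_const2) auto
  qed
qed

section \<open>Proper cones\<close>

locale pcone =
  fixes K :: "(real^'n) set"
  assumes proper: "proper_cone K"
begin

lemma closed_K: "closed K" and convex_K: "convex K" and interior_K: "interior K \<noteq> {}"
  using proper by (auto simp: proper_cone_def)

lemma zero_mem: "0 \<in> K"
  using proper by (auto simp: proper_cone_def)

lemma pointed: "x \<in> K \<Longrightarrow> -x \<in> K \<Longrightarrow> x = 0"
  using proper unfolding proper_cone_def by (metis IntI imageI minus_minus singletonD)

lemma scale_mem: "x \<in> K \<Longrightarrow> 0 \<le> r \<Longrightarrow> r *\<^sub>R x \<in> K"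
  using proper zero_mem unfolding proper_cone_def is_cone_def by (cases "r = 0") auto

lemma add_mem: assumes "x \<in> K" "y \<in> K" shows "x + y \<in> K"
proof -
  have "(1/2) *\<^sub>R x + (1/2) *\<^sub>R y \<in> K"
    using convexD[OF convex_K assms, of "1/2" "1/2"] by simp
  from scale_mem[OF this, of 2] show ?thesis by (simp add: scaleR_add_right)
qed

lemma sum_mem: "(\<And>i. i \<in> I \<Longrightarrow> g i \<in> K) \<Longrightarrow> sum g I \<in> K"
  by (induction I rule: infinite_finite_induct) (auto intro: add_mem zero_mem)

lemma pi_mem: "A \<in> pi_cone K \<Longrightarrow> x \<in> K \<Longrightarrow> A *v x \<in> K"
  by (auto simp: pi_cone_def)

lemma interior_add: assumes "x \<in> interior K" "y \<in> K" shows "x + y \<in> interior K"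
proof -
  have "(\<lambda>z. z + y) ` interior K \<subseteq> K"
    using add_mem assms(2) interior_subset by blast
  moreover have "open ((\<lambda>z. z + y) ` interior K)"
    using open_translation[of "interior K" y] by (simp add: add.commute)
  ultimately show ?thesis
    using assms(1) interior_maximal by blast
qed

text \<open>The unit vectors of \<open>K\<close> form a compact set whose convex hull misses
  \<open>0\<close> because \<open>K\<close> is pointed. A hyperplane strictly separating the hull
  from \<open>0\<close> is positive on it with a uniform margin \<open>b\<close>, and homogeneity
  extends the bound to all of \<open>K\<close>.\<close>

lemma strictly_positive_functional:
  obtains f b where "0 < b" "\<And>x. x \<in> K \<Longrightarrow> b * norm x \<le> f \<bullet> x"
proof -
  let ?C = "convex hull (K \<inter> sphere 0 1)"
  \<comment> \<open>Pointedness enters here: two nonzero vectors of the cone cannot cancel.\<close>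
  have conv: "convex (K - {0})"
  proof (rule convexI)
    fix x y and u v :: real
    assume x: "x \<in> K - {0}" and y: "y \<in> K - {0}" and uv: "0 \<le> u" "0 \<le> v" "u + v = 1"
    have m: "u *\<^sub>R x \<in> K" "v *\<^sub>R y \<in> K" using x y uv scale_mem by auto
    have "u *\<^sub>R x + v *\<^sub>R y \<noteq> 0"
    proof
      assume 0: "u *\<^sub>R x + v *\<^sub>R y = 0"
      then have "- (u *\<^sub>R x) = v *\<^sub>R y" by (simp add: neg_eq_iff_add_eq_0)
      then have "u *\<^sub>R x = 0" using pointed m by metis
      with 0 x y uv show False by auto
    qed
    then show "u *\<^sub>R x + v *\<^sub>R y \<in> K - {0}" using add_mem m by auto
  qed
  have "?C \<subseteq> K - {0}"
    using conv by (intro hull_minimal) auto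
  then have "0 \<notin> ?C" by auto
  moreover have "closed ?C"
    by (intro compact_imp_closed compact_convex_hull closed_Int_compact closed_K) auto
  ultimately obtain a b where ab: "0 < b" "\<And>x. x \<in> ?C \<Longrightarrow> b < a \<bullet> x"
    using separating_hyperplane_closed_0[of ?C] by auto
  have "b * norm x \<le> a \<bullet> x" if x: "x \<in> K" for x
  proof (cases "x = 0")
    case False
    have "(1 / norm x) *\<^sub>R x \<in> ?C"
      by (rule hull_inc) (use False x scale_mem in auto)
    from ab(2)[OF this] False show ?thesis by (simp add: field_simps)
  qed simp
  with ab(1) show thesis by (rule that)
qed

text \<open>By separation, a point outside the closed convex cone is detected by a functional that
  is nonnegative on \<open>K\<close>. If all of these vanish at \<open>x\<close>, neither
  \<open>x\<close> nor \<open>-x\<close> is outside \<open>K\<close>, and pointedness forces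
  \<open>x = 0\<close>.\<close>

lemma dual_separation:
  assumes "\<And>g. (\<And>y. y \<in> K \<Longrightarrow> 0 \<le> g \<bullet> y) \<Longrightarrow> norm g \<le> 1 \<Longrightarrow> g \<bullet> x = 0"
  shows "x = 0"
proof -
  have mem: "z \<in> K" if z: "z = x \<or> z = -x" for z
  proof (rule ccontr)
    assume "z \<notin> K"
    then obtain a b where ab: "a \<bullet> z < b" "\<And>y. y \<in> K \<Longrightarrow> b < a \<bullet> y"
      using separating_hyperplane_closed_point[OF convex_K closed_K] by metis
    have b: "b < 0" using ab(2)[OF zero_mem] by simp
    have a0: "a \<noteq> 0" using ab(1) b by auto
    \<comment> \<open>A functional bounded below on a cone is nonnegative there: if
      \<open>a \<bullet> y\<close> were negative, a positive multiple of \<open>y\<close> would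
      attain the excluded value \<open>b\<close>.\<close>
    have pos: "0 \<le> a \<bullet> y" if y: "y \<in> K" for y
    proof (rule ccontr)
      assume "\<not> ?thesis"
      then have neg: "a \<bullet> y < 0" by simp
      have "(b / (a \<bullet> y)) *\<^sub>R y \<in> K" using y neg b by (intro scale_mem) (auto simp: divide_nonpos_neg)
      from ab(2)[OF this] neg show False by simp
    qed
    have "((1 / norm a) *\<^sub>R a) \<bullet> x = 0"
      by (rule assms) (use pos a0 in \<open>auto\<close>)
    then have "a \<bullet> x = 0" using a0 by simp
    then have "a \<bullet> z = 0" using z by auto
    then show False using ab(1) b by simp
  qed
  show ?thesis by (intro pointed mem) auto
qed

text \<open>A ball around \<open>e\<close> lies in \<open>K\<close>, so \<open>e\<close> plus or
  minus a small multiple of any \<open>x\<close> stays in \<open>K\<close>. A positive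
  \<open>X\<close> preserves this sandwich, so its value at \<open>e\<close> alone controls its
  norm.\<close>

lemma opnorm_le_functional:
  assumes b: "0 < b" "\<And>x. x \<in> K \<Longrightarrow> b * norm x \<le> f \<bullet> x" and e: "e \<in> interior K"
  obtains C where "0 < C" "\<And>X. X \<in> pi_cone K \<Longrightarrow> opnorm X \<le> C * (f \<bullet> (X *v e))"
proof -
  obtain r where r: "r > 0" "cball e r \<subseteq> K"
    using e by (meson mem_interior_cball)
  have "opnorm X \<le> (1 / (r * b)) * (f \<bullet> (X *v e))" if X: "X \<in> pi_cone K" for X
  proof (rule opnorm_le)
    fix x
    show "norm (X *v x) \<le> 1 / (r * b) * (f \<bullet> (X *v e)) * norm x"
    proof (cases "x = 0")
      case False
      define c where "c = r / norm x"
      have c: "c > 0" using False r by (simp add: c_def)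
      have "e + c *\<^sub>R x \<in> K" "e - c *\<^sub>R x \<in> K"
        using r False by (auto intro!: subsetD[OF r(2)] simp: dist_norm c_def)
      then have "X *v e + c *\<^sub>R (X *v x) \<in> K" "X *v e - c *\<^sub>R (X *v x) \<in> K"
        using pi_mem[OF X] by (metis matrix_vector_right_distrib matrix_vector_mult_scaleR,
            metis matrix_vector_mult_diff_distrib matrix_vector_mult_scaleR)
      then have *: "b * norm (X *v e + c *\<^sub>R (X *v x)) \<le> f \<bullet> (X *v e) + c * (f \<bullet> (X *v x))"
        "b * norm (X *v e - c *\<^sub>R (X *v x)) \<le> f \<bullet> (X *v e) - c * (f \<bullet> (X *v x))"
        using b(2) by (fastforce simp: inner_simps)+
      \<comment> \<open>\<open>X *v x\<close> is, up to scaling, the difference of two vectors of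
        \<open>K\<close> whose \<open>f\<close>-values add up to twice
        \<open>f \<bullet> (X *v e)\<close>.\<close>
      have "2 * c * norm (X *v x) = norm ((X *v e + c *\<^sub>R (X *v x)) - (X *v e - c *\<^sub>R (X *v x)))"
        using c by (simp flip: scaleR_2)
      also have "\<dots> \<le> norm (X *v e + c *\<^sub>R (X *v x)) + norm (X *v e - c *\<^sub>R (X *v x))"
        by (rule norm_triangle_ineq4)
      finally have "b * (2 * c * norm (X *v x)) \<le> b * (norm (X *v e + c *\<^sub>R (X *v x)) + norm (X *v e - c *\<^sub>R (X *v x)))"
        using b(1) by simp
      also have "\<dots> \<le> 2 * (f \<bullet> (X *v e))" using * by (simp add: distrib_left)
      finally show ?thesis
        using r b False by (simp add: c_def field_simps)
    qed simp
  qed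
  then show thesis using that[of "1 / (r * b)"] r b by simp
qed

section \<open>Orbits of an irreducible matrix\<close>

lemma mat_pow_mem: "A \<in> pi_cone K \<Longrightarrow> x \<in> K \<Longrightarrow> mat_pow A j *v x \<in> K"
  by (induction j arbitrary: x) (auto simp: pi_mem simp flip: matrix_vector_mul_assoc)

lemma irreducible_orbit_covers:
  assumes irr: "K_irreducible K A" and x: "x \<in> K" "x \<noteq> 0" and y: "y \<in> K"
  obtains N c where "0 \<le> c" "c *\<^sub>R (\<Sum>j\<le>N. mat_pow A j *v x) - y \<in> K"
proof -
  have A: "A \<in> pi_cone K" using irr by (simp add: K_irreducible_def)
  define G where "G N = (\<Sum>j\<le>N. mat_pow A j *v x)" for N
  define F where "F = {y \<in> K. \<exists>N c. 0 \<le> c \<and> c *\<^sub>R G N - y \<in> K}"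
  \<comment> \<open>Partial sums grow in the cone order, so two dominating sums can be replaced by
    one with the larger index. Convexity of \<open>F\<close> rests on this.\<close>
  have G_mono: "c' *\<^sub>R G M - c *\<^sub>R G N \<in> K" if "N \<le> M" "0 \<le> c" "c \<le> c'" for N M c c'
  proof -
    have eq: "c' *\<^sub>R G M - c *\<^sub>R G N = (c' - c) *\<^sub>R G M + c *\<^sub>R (\<Sum>j\<in>{..M}-{..N}. mat_pow A j *v x)"
      using that by (simp add: G_def sum_diff algebra_simps)
    show ?thesis unfolding eq
      using that by (auto intro!: add_mem scale_mem sum_mem mat_pow_mem A x simp: G_def)
  qed
  have "is_cone F"
    unfolding is_cone_def
  proof (intro conjI allI impI ballI)
    have "0 \<in> F" unfolding F_def using zero_mem by (force intro!: exI[of _ "0::real"])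
    then show "F \<noteq> {}" by auto
    fix r :: real and z assume r: "0 < r" and z: "z \<in> F"
    then obtain N c where c: "z \<in> K" "0 \<le> c" "c *\<^sub>R G N - z \<in> K" by (auto simp: F_def)
    have "(r * c) *\<^sub>R G N - r *\<^sub>R z \<in> K"
      using scale_mem[OF c(3), of r] r by (simp add: algebra_simps)
    then show "r *\<^sub>R z \<in> F" unfolding F_def using c r scale_mem
      by (auto intro!: exI[of _ N] exI[of _ "r * c"])
  qed
  moreover have "convex F"
  proof (rule convexI)
    fix z w and u v :: real
    assume "z \<in> F" "w \<in> F" and uv: "0 \<le> u" "0 \<le> v" "u + v = 1"
    then obtain N c N' c' where c: "z \<in> K" "0 \<le> c" "c *\<^sub>R G N - z \<in> K"
      and c': "w \<in> K" "0 \<le> c'" "c' *\<^sub>R G N' - w \<in> K" by (auto simp: F_def)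
    let ?M = "max N N'"
    have "c *\<^sub>R G ?M - z \<in> K" "c' *\<^sub>R G ?M - w \<in> K"
      using add_mem[OF G_mono[of N ?M c c] c(3)] add_mem[OF G_mono[of N' ?M c' c'] c'(3)] c c' by auto
    then have "u *\<^sub>R (c *\<^sub>R G ?M - z) + v *\<^sub>R (c' *\<^sub>R G ?M - w) \<in> K"
      using uv by (intro add_mem scale_mem)
    then have "(u * c + v * c') *\<^sub>R G ?M - (u *\<^sub>R z + v *\<^sub>R w) \<in> K"
      by (simp add: algebra_simps)
    moreover have "u *\<^sub>R z + v *\<^sub>R w \<in> K" using uv c c' by (intro add_mem scale_mem)
    ultimately show "u *\<^sub>R z + v *\<^sub>R w \<in> F"
      unfolding F_def using uv c c' by (auto intro!: exI[of _ ?M] exI[of _ "u * c + v * c'"])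
  qed
  moreover have "F \<subseteq> K" by (auto simp: F_def)
  moreover have "z \<in> F" if "w \<in> F" "cone_ge K w z" "cone_ge K z 0" for w z
  proof -
    obtain N c where c: "w \<in> K" "0 \<le> c" "c *\<^sub>R G N - w \<in> K" using \<open>w \<in> F\<close> by (auto simp: F_def)
    have "c *\<^sub>R G N - z \<in> K"
      using add_mem[OF c(3), of "w - z"] that by (simp add: cone_ge_def)
    then show ?thesis using c that by (auto simp: F_def cone_ge_def)
  qed
  ultimately have face: "is_face K F" unfolding is_face_def by blast
  have "x \<in> F" unfolding F_def using x zero_mem
    by (auto intro!: exI[of _ "0::nat"] exI[of _ "1::real"] simp: G_def)
  then have "F \<noteq> {0}" using x by auto
  have "A *v z \<in> F" if z: "z \<in> F" for z
  proof -
    obtain N c where c: "z \<in> K" "0 \<le> c" "c *\<^sub>R G N - z \<in> K" using z by (auto simp: F_def)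
    \<comment> \<open>This shift makes \<open>F\<close> invariant: \<open>A\<close> turns domination
      by \<open>G N\<close> into domination by \<open>G (Suc N)\<close>.\<close>
    have "G (Suc N) = x + A *v G N"
    proof (induction N)
      case (Suc N)
      have "G (Suc (Suc N)) = G (Suc N) + A *v (mat_pow A (Suc N) *v x)"
        by (simp add: G_def matrix_vector_mul_assoc)
      also have "\<dots> = x + A *v (G N + mat_pow A (Suc N) *v x)"
        unfolding Suc by (simp add: matrix_vector_right_distrib)
      also have "G N + mat_pow A (Suc N) *v x = G (Suc N)"
        by (simp add: G_def)
      finally show ?case .
    qed (simp add: G_def)
    then have "c *\<^sub>R G (Suc N) - A *v z = c *\<^sub>R x + A *v (c *\<^sub>R G N - z)"
      by (simp add: algebra_simps)
    also have "\<dots> \<in> K" using c x A by (intro add_mem scale_mem pi_mem)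
    finally show ?thesis using c pi_mem[OF A] by (auto simp: F_def)
  qed
  then have "F = K"
    using irr face \<open>F \<noteq> {0}\<close> unfolding K_irreducible_def nontrivial_face_def by blast
  then show thesis using y that by (auto simp: F_def G_def)
qed

text \<open>The sets \<open>U k\<close> are open and cover the compact set of unit vectors of
  \<open>K\<close>, so finitely many suffice, and the largest index serves for all of them. Other
  lengths follow by scaling.\<close>

lemma irreducible_uniform_cover:
  assumes irr: "K_irreducible K A" and e: "e \<in> interior K"
  obtains k :: nat where
    "\<And>x. x \<in> K \<Longrightarrow> real (Suc k) *\<^sub>R (\<Sum>j\<le>k. mat_pow A j *v x) - norm x *\<^sub>R e \<in> K"
proof -
  have A: "A \<in> pi_cone K" using irr by (simp add: K_irreducible_def)
  have eK: "e \<in> K" using e interior_subset by auto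
  define G where "G N x = (\<Sum>j\<le>N. mat_pow A j *v x)" for N x
  \<comment> \<open>The single index \<open>k\<close> bounds both the number of powers and the
    multiple, so that domination persists when \<open>k\<close> increases.\<close>
  define H where "H k x = real (Suc k) *\<^sub>R G k x - e" for k x
  define U where "U k = H k -` interior K" for k
  have mono: "c' *\<^sub>R G M x - c *\<^sub>R G N x \<in> K" if "x \<in> K" "N \<le> M" "0 \<le> c" "c \<le> c'" for N M c c' x
  proof -
    have eq: "c' *\<^sub>R G M x - c *\<^sub>R G N x = (c' - c) *\<^sub>R G M x + c *\<^sub>R (\<Sum>j\<in>{..M}-{..N}. mat_pow A j *v x)"
      using that by (simp add: G_def sum_diff algebra_simps)
    show ?thesis unfolding eq
      using that by (auto intro!: add_mem scale_mem sum_mem mat_pow_mem A simp: G_def)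
  qed
  have "open (U k)" for k
    unfolding U_def H_def G_def
    by (intro open_vimage continuous_intros linear_continuous_on matrix_vector_mul_bounded_linear) auto
  moreover have "K \<inter> sphere 0 1 \<subseteq> (\<Union>k\<in>UNIV. U k)"
  proof
    fix x assume "x \<in> K \<inter> sphere 0 1"
    then have x: "x \<in> K" "x \<noteq> 0" by auto
    \<comment> \<open>Covering \<open>e + e\<close> instead of \<open>e\<close> leaves one copy of
      \<open>e\<close> to spare, which puts \<open>H k x\<close> into the interior; openness of
      \<open>U k\<close> requires the interior.\<close>
    obtain N c where c: "0 \<le> c" "c *\<^sub>R G N x - (e + e) \<in> K"
      using irreducible_orbit_covers[OF irr x add_mem[OF eK eK]] unfolding G_def by metis
    obtain k where k: "N \<le> k" "c \<le> real (Suc k)"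
      by (metis linear max.cobounded1 max.cobounded2 of_nat_mono order_trans real_arch_simple le_SucI)
    have "e + ((c *\<^sub>R G N x - (e + e)) + (real (Suc k) *\<^sub>R G k x - c *\<^sub>R G N x)) \<in> interior K"
      using k c x by (intro interior_add e add_mem mono) auto
    then have "x \<in> U k" by (simp add: U_def H_def algebra_simps)
    then show "x \<in> (\<Union>k\<in>UNIV. U k)" by auto
  qed
  moreover have "compact (K \<inter> sphere 0 1)"
    by (intro closed_Int_compact closed_K) auto
  ultimately obtain I where I: "finite I" "K \<inter> sphere 0 1 \<subseteq> (\<Union>k\<in>I. U k)"
    by (metis compactE_image subset_UNIV)
  define k where "k = Max (insert 0 I)"
  have "real (Suc k) *\<^sub>R G k x - norm x *\<^sub>R e \<in> K" if x: "x \<in> K" for x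
  proof (cases "x = 0")
    case True
    then show ?thesis by (simp add: G_def zero_mem)
  next
    case False
    let ?y = "(1 / norm x) *\<^sub>R x"
    have y: "?y \<in> K" using x by (simp add: scale_mem)
    then obtain i where i: "i \<in> I" "?y \<in> U i" using I(2) False by auto
    have ik: "i \<le> k" using I i by (simp add: k_def)
    have "H i ?y \<in> K" using i interior_subset by (auto simp: U_def)
    from add_mem[OF this mono[OF y ik, of "real (Suc i)" "real (Suc k)"]] ik
    have "real (Suc k) *\<^sub>R G k ?y - e \<in> K" by (simp add: H_def)
    from scale_mem[OF this, of "norm x"]
    have "norm x *\<^sub>R (real (Suc k) *\<^sub>R G k ?y - e) \<in> K" by simp
    moreover have "G k ?y = (1 / norm x) *\<^sub>R G k x"
      by (simp add: G_def scaleR_sum_right matrix_vector_mult_scaleR)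
    ultimately show ?thesis using False by (simp add: scaleR_diff_right del: of_nat_Suc)
  qed
  then show thesis using that unfolding G_def by blast
qed

end

section \<open>Growth of irreducible semigroups\<close>

text \<open>Common ground of the three constructions. Only positive times are constrained, since
  with jumps time \<open>0\<close> may contain projections. The irreducible element lies in the hull
  of the closure because, with jumps, the exact semigroup is merely dense in the given
  family.\<close>

locale cone_semigroup = pcone K for K :: "(real^'n) set" +
  fixes T :: "real set" and E :: "real \<Rightarrow> 'n mat set" and t0 :: real and A :: "'n mat"
  assumes T_add: "\<And>s t. s \<in> T \<Longrightarrow> t \<in> T \<Longrightarrow> s + t \<in> T"
    and T_diff: "\<And>s t. s \<in> T \<Longrightarrow> t \<in> T \<Longrightarrow> s < t \<Longrightarrow> t - s \<in> T"
    and E_pi: "\<And>t. t \<in> T \<Longrightarrow> 0 < t \<Longrightarrow> E t \<subseteq> pi_cone K"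
    and E_mult: "\<And>s t X Y. \<lbrakk>s \<in> T; 0 < s; t \<in> T; 0 < t; X \<in> E s; Y \<in> E t\<rbrakk> \<Longrightarrow> X ** Y \<in> E (s + t)"
    and E_split: "\<And>s t Z. \<lbrakk>s \<in> T; 0 < s; t \<in> T; 0 < t; Z \<in> E (s + t)\<rbrakk> \<Longrightarrow> \<exists>X\<in>E s. \<exists>Y\<in>E t. Z = X ** Y"
    and E_bdd: "\<And>b. \<exists>B. \<forall>t\<in>T. 0 < t \<longrightarrow> t \<le> b \<longrightarrow> (\<forall>X\<in>E t. opnorm X \<le> B)"
    and t0: "t0 \<in> T" "0 < t0"
    and A_hull: "A \<in> convex hull (closure (E t0))"
    and A_irr: "K_irreducible K A"
begin

section \<open>Times and nonemptiness\<close>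

lemma multiple_mem: "real (Suc n) * t0 \<in> T"
proof (induction n)
  case (Suc n)
  from T_add[OF Suc t0(1)] show ?case by (simp add: algebra_simps)
qed (use t0 in simp)

lemma shift_mem: "s \<in> T \<Longrightarrow> s + real j * t0 \<in> T"
  using multiple_mem[of "j - 1"] T_add by (cases j) auto

lemma exists_large: obtains t where "t \<in> T" "b < t" "0 < t"
proof -
  obtain n where "b / t0 < real n" using reals_Archimedean2 by blast
  then have "b < real (Suc n) * t0" using t0 by (simp add: field_simps)
  with multiple_mem[of n] t0 show thesis by (intro that[of "real (Suc n) * t0"]) auto
qed

text \<open>Products give elements at every multiple of \<open>t0\<close>. Splitting one at a
  multiple beyond \<open>t\<close> produces an element at time \<open>t\<close>.\<close>

lemma E_nonempty: assumes "t \<in> T" "0 < t" shows "E t \<noteq> {}"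
proof -
  have 0: "E t0 \<noteq> {}" using A_hull by auto
  have multiple: "E (real (Suc n) * t0) \<noteq> {}" for n
  proof (induction n)
    case (Suc n)
    then obtain X Y where "X \<in> E (real (Suc n) * t0)" "Y \<in> E t0" using 0 by auto
    moreover have "0 < real (Suc n) * t0" using t0 by simp
    ultimately have "X ** Y \<in> E (real (Suc n) * t0 + t0)" using E_mult multiple_mem t0 by blast
    then show ?case by (auto simp: algebra_simps)
  qed (use 0 in simp)
  obtain n where "t / t0 < real n" using reals_Archimedean2 by blast
  then have n: "t < real (Suc n) * t0" using t0 by (simp add: field_simps)
  obtain Z where Z: "Z \<in> E (t + (real (Suc n) * t0 - t))" using multiple[of n] by auto
  show ?thesis
    using E_split[OF assms T_diff[OF assms(1) multiple_mem n] _ Z] n by auto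
qed

section \<open>The growth function and its rate\<close>

definition growth :: "real \<Rightarrow> real" where
  "growth t = (SUP X\<in>E t. opnorm X)"

lemma growth_bdd: assumes "t \<in> T" "0 < t" shows "bdd_above (opnorm ` E t)"
proof -
  obtain B where "\<forall>t'\<in>T. 0 < t' \<longrightarrow> t' \<le> t \<longrightarrow> (\<forall>X\<in>E t'. opnorm X \<le> B)" using E_bdd[of t] by auto
  then show ?thesis using assms by (intro bdd_aboveI[of _ B]) auto
qed

lemma opnorm_le_growth: "t \<in> T \<Longrightarrow> 0 < t \<Longrightarrow> X \<in> E t \<Longrightarrow> opnorm X \<le> growth t"
  unfolding growth_def by (intro cSUP_upper growth_bdd)

lemma growth_le: "t \<in> T \<Longrightarrow> 0 < t \<Longrightarrow> (\<And>X. X \<in> E t \<Longrightarrow> opnorm X \<le> c) \<Longrightarrow> growth t \<le> c"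
  unfolding growth_def by (intro cSUP_least E_nonempty)

lemma growth_nonneg: "t \<in> T \<Longrightarrow> 0 < t \<Longrightarrow> 0 \<le> growth t"
  using E_nonempty opnorm_le_growth opnorm_nonneg by (metis all_not_in_conv order_trans)

lemma growth_submult:
  assumes "s \<in> T" "0 < s" "t \<in> T" "0 < t" shows "growth (s + t) \<le> growth s * growth t"
proof (rule growth_le)
  fix Z assume "Z \<in> E (s + t)"
  then obtain X Y where XY: "X \<in> E s" "Y \<in> E t" "Z = X ** Y" using E_split[OF assms] by blast
  have "opnorm Z \<le> opnorm X * opnorm Y" unfolding XY by (rule opnorm_mult)
  also have "\<dots> \<le> growth s * growth t"
    using assms XY by (intro mult_mono opnorm_le_growth growth_nonneg opnorm_nonneg)
  finally show "opnorm Z \<le> growth s * growth t" .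
qed (use assms T_add in auto)

text \<open>Restricting \<open>at_top\<close> to \<open>T\<close> lets discrete and continuous time
  share one limit; this is the filter in \<open>jsr\<close>.\<close>

definition time_filter :: "real filter" where
  "time_filter = inf at_top (principal T)"

lemma time_filter_nontrivial: "time_filter \<noteq> bot"
proof
  assume "time_filter = bot"
  then have "eventually (\<lambda>t. t \<notin> T) at_top"
    unfolding trivial_limit_def[symmetric] by (simp add: time_filter_def trivial_limit_def eventually_inf_principal)
  then obtain b where "\<And>t. b \<le> t \<Longrightarrow> t \<notin> T" by (auto simp: eventually_at_top_linorder)
  then show False using exists_large[of b] by (metis less_le)
qed

text \<open>Blocks of length \<open>t1\<close> are peeled off by submultiplicativity, each costing
  at most \<open>\<beta> powr t1\<close>. The last piece has length at most \<open>t1\<close> and is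
  absorbed into \<open>C\<close>.\<close>

lemma growth_exponential:
  assumes t1: "t1 \<in> T" "0 < t1" and \<beta>: "0 < \<beta>" "growth t1 \<le> \<beta> powr t1"
  obtains C where "0 < C" "\<And>t. t \<in> T \<Longrightarrow> 0 < t \<Longrightarrow> growth t \<le> C * \<beta> powr t"
proof -
  obtain B where B: "\<And>t X. t \<in> T \<Longrightarrow> 0 < t \<Longrightarrow> t \<le> t1 \<Longrightarrow> X \<in> E t \<Longrightarrow> opnorm X \<le> B"
    using E_bdd[of t1] by auto
  \<comment> \<open>A lower bound for \<open>\<beta> powr t\<close> on times up to
    \<open>t1\<close>: it is at least \<open>1\<close> if \<open>\<beta> \<ge> 1\<close> and
    decreases to \<open>\<beta> powr t1\<close> otherwise.\<close>
  define m where "m = min 1 (\<beta> powr t1)"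
  have m: "0 < m" "\<And>t. 0 < t \<Longrightarrow> t \<le> t1 \<Longrightarrow> m \<le> \<beta> powr t"
  proof -
    show "0 < m" using \<beta> by (simp add: m_def)
    fix t assume t: "0 < t" "t \<le> t1"
    show "m \<le> \<beta> powr t"
    proof (cases "\<beta> \<ge> 1")
      case True
      then show ?thesis using t by (simp add: m_def ge_one_powr_ge_zero min.coboundedI1)
    next
      case False
      then have "\<beta> powr t1 \<le> \<beta> powr t" using t \<beta> by (intro powr_mono') auto
      then show ?thesis by (simp add: m_def)
    qed
  qed
  define C where "C = (\<bar>B\<bar> + 1) / m"
  have C: "0 < C" using m by (simp add: C_def)
  have step: "\<forall>t\<in>T. 0 < t \<longrightarrow> t \<le> real (Suc n) * t1 \<longrightarrow> growth t \<le> C * \<beta> powr t" for n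
  proof (induction n)
    case 0
    show ?case
    proof (intro ballI impI)
      fix t assume t: "t \<in> T" "0 < t" "t \<le> real (Suc 0) * t1"
      have "growth t \<le> B" using t B by (intro growth_le) auto
      also have "\<dots> \<le> C * m" using m by (simp add: C_def)
      also have "\<dots> \<le> C * \<beta> powr t" using m(2)[of t] t C by (intro mult_left_mono) auto
      finally show "growth t \<le> C * \<beta> powr t" .
    qed
  next
    case (Suc n)
    show ?case
    proof (intro ballI impI)
      fix t assume t: "t \<in> T" "0 < t" "t \<le> real (Suc (Suc n)) * t1"
      show "growth t \<le> C * \<beta> powr t"
      proof (cases "t \<le> real (Suc n) * t1")
        case False
        \<comment> \<open>Strictness keeps the remainder \<open>t - t1\<close> positive, as
          submultiplicativity is stated for positive times only.\<close>
        have gt: "t1 < t"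
        proof -
          have "t1 \<le> real (Suc n) * t1" using t1(2) by simp
          then show ?thesis using False by linarith
        qed
        have d: "t - t1 \<in> T" "0 < t - t1" using T_diff[OF t1(1) t(1) gt] gt by auto
        have "growth t \<le> growth t1 * growth (t - t1)"
          using growth_submult[OF t1 d] by simp
        also have "\<dots> \<le> \<beta> powr t1 * (C * \<beta> powr (t - t1))"
          using Suc d t by (intro mult_mono \<beta>(2) growth_nonneg) (auto simp: algebra_simps)
        also have "\<dots> = C * \<beta> powr t" by (simp add: powr_diff \<beta>(1))
        finally show ?thesis .
      qed (use Suc t in auto)
    qed
  qed
  have "growth t \<le> C * \<beta> powr t" if t: "t \<in> T" "0 < t" for t
  proof -
    obtain n where "t / t1 < real n" using reals_Archimedean2 by blast
    then have "t \<le> real (Suc n) * t1" using t1 by (simp add: field_simps)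
    then show ?thesis using step[of n] t by blast
  qed
  with C show thesis by (rule that)
qed

text \<open>Fekete's lemma: the limit is the infimum of the roots. The lower estimate is immediate.
  For the upper one, a time whose root is close to the infimum feeds
  \<open>growth_exponential\<close>, and the constant there tends to \<open>1\<close> under the
  root.\<close>

lemma growth_rate_exists:
  obtains \<rho> where "0 \<le> \<rho>" "((\<lambda>t. growth t powr (1 / t)) \<longlongrightarrow> \<rho>) time_filter"
proof -
  define R where "R = (\<lambda>t. growth t powr (1 / t)) ` {t \<in> T. 0 < t}"
  define \<rho> where "\<rho> = Inf R"
  have R: "R \<noteq> {}" "bdd_below R" using t0 by (auto simp: R_def intro!: bdd_belowI[of _ 0])
  have \<rho>: "0 \<le> \<rho>" unfolding \<rho>_def using R by (intro cInf_greatest) (auto simp: R_def)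
  have "((\<lambda>t. growth t powr (1 / t)) \<longlongrightarrow> \<rho>) time_filter"
  proof (rule order_tendstoI)
    fix a assume a: "a < \<rho>"
    have "a < growth t powr (1 / t)" if "t \<in> T" "1 \<le> t" for t
    proof -
      have "\<rho> \<le> growth t powr (1 / t)" unfolding \<rho>_def
        using that by (intro cInf_lower R) (auto simp: R_def)
      with a show ?thesis by simp
    qed
    then show "eventually (\<lambda>t. a < growth t powr (1 / t)) time_filter"
      unfolding time_filter_def eventually_inf_principal
      by (intro eventually_mono[OF eventually_ge_at_top[of "1::real"]]) auto
  next
    fix a assume a: "\<rho> < a"
    define \<beta> where "\<beta> = (\<rho> + a) / 2"
    have \<beta>: "\<rho> < \<beta>" "\<beta> < a" "0 < \<beta>" using a \<rho> by (auto simp: \<beta>_def)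
    then obtain t1 where t1: "t1 \<in> T" "0 < t1" "growth t1 powr (1 / t1) < \<beta>"
      using R unfolding \<rho>_def by (auto simp: R_def cInf_less_iff)
    have "growth t1 = (growth t1 powr (1 / t1)) powr t1"
      using growth_nonneg[OF t1(1,2)] t1 by (simp add: powr_powr)
    also have "\<dots> \<le> \<beta> powr t1" using t1 by (intro powr_mono2) auto
    finally obtain C where C: "0 < C" "\<And>t. t \<in> T \<Longrightarrow> 0 < t \<Longrightarrow> growth t \<le> C * \<beta> powr t"
      using growth_exponential[OF t1(1,2) \<beta>(3)] by blast
    have "((\<lambda>t. C powr (1 / t) * \<beta>) \<longlongrightarrow> C powr 0 * \<beta>) at_top"
      using C(1) by (intro tendsto_intros tendsto_divide_0[OF tendsto_const] filterlim_at_top_imp_at_infinity filterlim_ident) auto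
    then have "eventually (\<lambda>t. C powr (1 / t) * \<beta> < a) at_top"
      using C(1) \<beta>(2) by (intro order_tendstoD) auto
    then have "eventually (\<lambda>t. t \<in> T \<longrightarrow> growth t powr (1 / t) < a) at_top"
      using eventually_gt_at_top[of 0]
    proof eventually_elim
      case (elim t)
      show ?case
      proof
        assume t: "t \<in> T"
        have "growth t powr (1 / t) \<le> (C * \<beta> powr t) powr (1 / t)"
          using C(2)[OF t] elim growth_nonneg t by (intro powr_mono2) auto
        also have "\<dots> = C powr (1 / t) * \<beta>"
          using C(1) \<beta>(3) elim by (simp add: powr_mult powr_powr)
        finally show "growth t powr (1 / t) < a" using elim by simp
      qed
    qed
    then show "eventually (\<lambda>t. growth t powr (1 / t) < a) time_filter"
      by (simp add: time_filter_def eventually_inf_principal)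
  qed
  with \<rho> show thesis by (rule that)
qed

text \<open>Powers of \<open>A\<close> need not belong to the semigroup, as \<open>A\<close> is only
  in a convex hull. A continuous linear functional bounded on \<open>E t0\<close> obeys the same
  bound on the closed hull, so the factors \<open>A\<close> are exchanged one at a time for elements
  of \<open>E t0\<close>, each absorbed into \<open>X\<close>.\<close>

lemma functional_hull_le:
  assumes s: "s \<in> T" "0 < s" "X \<in> E s" and t: "t \<in> T" "0 < t" "Y \<in> E t"
  shows "f \<bullet> ((X ** mat_pow A j ** Y) *v e) \<le> norm f * norm e * growth (s + t + real j * t0)"
  using s
proof (induction j arbitrary: s X)
  case 0
  have XY: "X ** Y \<in> E (s + t)" using E_mult 0 t by blast
  have "f \<bullet> ((X ** Y) *v e) \<le> norm f * norm ((X ** Y) *v e)" by (rule norm_cauchy_schwarz)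
  also have "\<dots> \<le> norm f * (opnorm (X ** Y) * norm e)"
    by (intro mult_left_mono norm_matrix_vector_le) auto
  also have "\<dots> \<le> norm f * (growth (s + t) * norm e)"
    using XY 0 t T_add by (intro mult_left_mono mult_right_mono opnorm_le_growth) auto
  finally show ?case by (simp add: mult_ac)
next
  case (Suc j)
  let ?P = "mat_pow A j ** Y"
  \<comment> \<open>Only the leftmost factor \<open>A\<close> is made variable; linearity and
    continuity in it are all that the passage to the hull uses.\<close>
  define L where "L W = f \<bullet> ((X ** W ** ?P) *v e)" for W
  have "bounded_linear L"
    unfolding L_def
    by (intro bounded_linear_compose[OF bounded_linear_inner_right]
        bounded_linear_compose[OF bounded_bilinear.bounded_linear_left[OF bounded_bilinear_matrix_vector_mult]]
        bounded_linear_compose[OF bounded_bilinear.bounded_linear_left[OF bounded_bilinear_matrix_matrix_mult]]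
        bounded_bilinear.bounded_linear_right[OF bounded_bilinear_matrix_matrix_mult])
  then have L: "linear L" "continuous_on UNIV L"
    by (auto simp: linear_continuous_on bounded_linear.linear)
  define c where "c = norm f * norm e * growth (s + t + real (Suc j) * t0)"
  have "E t0 \<subseteq> L -` {..c}"
  proof
    fix W assume W: "W \<in> E t0"
    have "X ** W \<in> E (s + t0)" using E_mult Suc.prems t0 W by blast
    from Suc.IH[OF _ _ this] Suc.prems t0 T_add
    show "W \<in> L -` {..c}" by (simp add: L_def c_def matrix_mul_assoc algebra_simps)
  qed
  moreover have "closed (L -` {..c})" using L(2) by (intro continuous_closed_vimage) (auto simp: continuous_on_eq_continuous_at)
  ultimately have "closure (E t0) \<subseteq> L -` {..c}" by (rule closure_minimal)
  moreover have "convex (L -` {..c})" by (intro convex_linear_vimage L convex_real_interval)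
  ultimately have "convex hull (closure (E t0)) \<subseteq> L -` {..c}" by (rule hull_minimal)
  then have "L A \<le> c" using A_hull by auto
  then show ?case by (simp add: L_def c_def matrix_mul_assoc)
qed

text \<open>For \<open>x\<close> in the cone, a multiple of the sum of the first powers of the irreducible element
  applied to \<open>x\<close> dominates an interior point, so some power joins two factors at a bounded cost in
  time and norm.\<close>
lemma growth_supermult:
  obtains \<kappa> k where "0 < \<kappa>"
    "\<And>s t X Y. \<lbrakk>s \<in> T; 0 < s; X \<in> E s; t \<in> T; 0 < t; Y \<in> E t\<rbrakk> \<Longrightarrow>
      \<exists>j\<le>k::nat. \<exists>Z\<in>E (s + t + real j * t0). \<kappa> * opnorm X * opnorm Y \<le> opnorm Z"
proof -
  obtain f b where b: "0 < b" "\<And>x. x \<in> K \<Longrightarrow> b * norm x \<le> f \<bullet> x"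
    using strictly_positive_functional by blast
  obtain e where e: "e \<in> interior K" using interior_K by auto
  then have eK: "e \<in> K" using interior_subset by auto
  obtain C where C: "0 < C" "\<And>X. X \<in> pi_cone K \<Longrightarrow> opnorm X \<le> C * (f \<bullet> (X *v e))"
    using opnorm_le_functional[OF b e] by blast
  obtain k where k: "\<And>x. x \<in> K \<Longrightarrow> real (Suc k) *\<^sub>R (\<Sum>j\<le>k. mat_pow A j *v x) - norm x *\<^sub>R e \<in> K"
    using irreducible_uniform_cover[OF A_irr e] by blast
  define F where "F = norm f * norm e + 1"
  have F: "0 < F" by (simp add: F_def add_nonneg_pos)
  \<comment> \<open>\<open>d\<close> collects the losses: \<open>C\<close> once each for
    \<open>X\<close> and \<open>Y\<close>, \<open>norm f + 1\<close> for bounding \<open>f\<close>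
    on \<open>Y *v e\<close>, \<open>F\<close> from \<open>functional_hull_le\<close>, and
    \<open>Suc k\<close> from the cover. The added ones keep it positive.\<close>
  define d where "d = real (Suc k) * C^2 * (norm f + 1) * F"
  have d: "0 < d" unfolding d_def using C F by (intro mult_pos_pos) (auto simp: add_nonneg_pos)
  have half_less: "y / 2 < y" if "0 < y" for y :: real using that by simp
  have dual_nonneg: "0 \<le> f \<bullet> x" if "x \<in> K" for x
    using b(2)[OF that] b(1) by (smt (verit) mult_nonneg_nonneg norm_ge_zero)
  have *: "\<exists>j\<le>k. \<exists>Z\<in>E (s + t + real j * t0). (1 / (2 * d * real (Suc k))) * opnorm X * opnorm Y \<le> opnorm Z"
    if s: "s \<in> T" "0 < s" "X \<in> E s" and t: "t \<in> T" "0 < t" "Y \<in> E t" for s t X Y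
  proof -
    have Xp: "X \<in> pi_cone K" and Yp: "Y \<in> pi_cone K" using E_pi s t by auto
    let ?u = "\<lambda>j. s + t + real j * t0"
    have u: "?u j \<in> T" "0 < ?u j" for j using shift_mem T_add s t t0 by (auto intro!: add_pos_nonneg)
    define x where "x = Y *v e"
    have x: "x \<in> K" unfolding x_def using Yp eK by (rule pi_mem)
    \<comment> \<open>The uniform cover is applied to \<open>x = Y *v e\<close> and pushed through
      the positive maps \<open>X\<close> and \<open>f\<close>.\<close>
    have "0 \<le> f \<bullet> (X *v (real (Suc k) *\<^sub>R (\<Sum>j\<le>k. mat_pow A j *v x) - norm x *\<^sub>R e))"
      by (intro dual_nonneg pi_mem Xp k x)
    then have "norm x * (f \<bullet> (X *v e)) \<le> real (Suc k) * (\<Sum>j\<le>k. f \<bullet> (X *v (mat_pow A j *v x)))"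
      by (simp add: matrix_vector_mult_diff_distrib matrix_vector_mult_scaleR inner_diff_right
          linear_sum[OF matrix_vector_mul_linear] inner_sum_right del: of_nat_Suc)
    also have "\<dots> \<le> real (Suc k) * (\<Sum>j\<le>k. F * growth (?u j))"
    proof (intro mult_left_mono sum_mono)
      fix j
      have "f \<bullet> (X *v (mat_pow A j *v x)) = f \<bullet> ((X ** mat_pow A j ** Y) *v e)"
        by (simp add: x_def matrix_vector_mul_assoc matrix_mul_assoc)
      also have "\<dots> \<le> norm f * norm e * growth (?u j)" by (rule functional_hull_le[OF s t])
      also have "\<dots> \<le> F * growth (?u j)" using growth_nonneg[OF u] by (intro mult_right_mono) (auto simp: F_def)
      finally show "f \<bullet> (X *v (mat_pow A j *v x)) \<le> F * growth (?u j)" .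
    qed auto
    finally have 1: "norm x * (f \<bullet> (X *v e)) \<le> real (Suc k) * F * (\<Sum>j\<le>k. growth (?u j))"
      by (simp add: sum_distrib_left mult_ac)
    have "f \<bullet> x \<le> norm f * norm x" by (rule norm_cauchy_schwarz)
    also have "\<dots> \<le> (norm f + 1) * norm x" by (intro mult_right_mono) auto
    finally have "opnorm Y \<le> C * ((norm f + 1) * norm x)"
      using C(2)[OF Yp] C(1) unfolding x_def by (meson mult_left_mono order_trans less_imp_le)
    then have "opnorm X * opnorm Y \<le> (C * (f \<bullet> (X *v e))) * (C * ((norm f + 1) * norm x))"
      using C(2)[OF Xp] C(1) opnorm_nonneg[of X] opnorm_nonneg[of Y] by (intro mult_mono) auto
    also have "\<dots> = C^2 * (norm f + 1) * (norm x * (f \<bullet> (X *v e)))" by (simp add: power2_eq_square)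
    also have "\<dots> \<le> C^2 * (norm f + 1) * (real (Suc k) * F * (\<Sum>j\<le>k. growth (?u j)))"
      using 1 by (intro mult_left_mono) auto
    also have "\<dots> = d * (\<Sum>j\<le>k. growth (?u j))" by (simp add: d_def mult_ac)
    finally have 2: "opnorm X * opnorm Y \<le> d * (\<Sum>j\<le>k. growth (?u j))" .
    show ?thesis
    proof (cases "opnorm X * opnorm Y = 0")
      case True
      obtain Z where "Z \<in> E (?u 0)" using E_nonempty[OF u, of 0] by auto
      then show ?thesis using True opnorm_nonneg[of Z] by (intro exI[of _ 0]) (auto simp: mult.assoc)
    next
      case False
      then have pos: "0 < opnorm X * opnorm Y" using opnorm_nonneg[of X] opnorm_nonneg[of Y]
        by (metis less_eq_real_def mult_nonneg_nonneg)
      \<comment> \<open>Pigeonhole: one of the \<open>Suc k\<close> delays carries at least the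
        average.\<close>
      have "\<exists>j\<le>k. opnorm X * opnorm Y / (d * real (Suc k)) \<le> growth (?u j)"
      proof (rule ccontr)
        assume "\<not> ?thesis"
        then have "(\<Sum>j\<le>k. growth (?u j)) < (\<Sum>j\<le>k. opnorm X * opnorm Y / (d * real (Suc k)))"
          by (intro sum_strict_mono) auto
        also have "\<dots> = opnorm X * opnorm Y / d" using d by (simp del: of_nat_Suc)
        finally show False using 2 d by (simp add: field_simps)
      qed
      then obtain j where j: "j \<le> k" "opnorm X * opnorm Y / (d * real (Suc k)) \<le> growth (?u j)" by blast
      \<comment> \<open>Halving makes the inequality strict, so that an actual element
        \<open>Z\<close>, and not only the supremum \<open>growth\<close>, exceeds the
        bound.\<close>
      have "(1 / (2 * d * real (Suc k))) * opnorm X * opnorm Y = (opnorm X * opnorm Y / (d * real (Suc k))) / 2"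
        by simp
      also have "\<dots> < opnorm X * opnorm Y / (d * real (Suc k))"
      proof -
        have "0 < opnorm X * opnorm Y / (d * real (Suc k))" using pos d by (intro divide_pos_pos) auto
        then show ?thesis by (rule half_less)
      qed
      also note j(2)
      finally have "\<exists>Z\<in>E (?u j). (1 / (2 * d * real (Suc k))) * opnorm X * opnorm Y < opnorm Z"
        unfolding growth_def using less_cSUP_iff[OF E_nonempty[OF u] growth_bdd[OF u]] by blast
      then show ?thesis using j(1) less_imp_le by blast
    qed
  qed
  show thesis
    by (rule that[of "1 / (2 * d * real (Suc k))" k]) (use d * in auto)
qed

text \<open>The assumption \<open>large\<close> says that \<open>opnorm X\<close> beats
  \<open>\<alpha> powr s\<close> by enough to pay for \<open>\<kappa>\<close> and for any delay.
  Each further copy of \<open>X\<close> then gains a factor \<open>2\<close> over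
  \<open>\<alpha>\<close> to the elapsed time while using at most \<open>s + real k * t0\<close> of
  time, so the rate lies strictly above \<open>\<alpha>\<close>.\<close>

lemma growth_rate_gt:
  assumes lim: "((\<lambda>t. growth t powr (1 / t)) \<longlongrightarrow> \<rho>) time_filter"
    and sup: "\<And>s t X Y. \<lbrakk>s \<in> T; 0 < s; X \<in> E s; t \<in> T; 0 < t; Y \<in> E t\<rbrakk> \<Longrightarrow>
      \<exists>j\<le>k::nat. \<exists>Z\<in>E (s + t + real j * t0). \<kappa> * opnorm X * opnorm Y \<le> opnorm Z"
    and \<alpha>: "0 < \<alpha>" and s: "s \<in> T" "0 < s" "X \<in> E s"
    and large: "2 \<le> \<kappa> * min 1 (\<alpha> powr (- real k * t0)) * \<alpha> powr (- s) * opnorm X" and \<kappa>: "0 < \<kappa>"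
  shows "\<alpha> < \<rho>"
proof (rule ccontr)
  assume "\<not> ?thesis"
  then have \<rho>: "\<rho> \<le> \<alpha>" by simp
  define L where "L = s + real k * t0"
  have L: "0 < L" using s t0 by (auto simp: L_def intro!: add_pos_nonneg)
  have Xpos: "0 < opnorm X"
    using large opnorm_nonneg[of X] by (cases "opnorm X = 0") auto
  \<comment> \<open>The minimum in \<open>large\<close> is a lower bound for the correction over all
    delays, whether \<open>\<alpha>\<close> is above or below \<open>1\<close>.\<close>
  have gain: "2 * \<alpha> powr (s + real j * t0) \<le> \<kappa> * opnorm X" if "j \<le> k" for j
  proof -
    have "min 1 (\<alpha> powr (- real k * t0)) \<le> \<alpha> powr (- (real j * t0))"
    proof (cases "1 \<le> \<alpha>")
      case True
      then have "\<alpha> powr (- real k * t0) \<le> \<alpha> powr (- (real j * t0))"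
        using that t0 by (intro powr_mono) (auto simp: mult_right_mono)
      then show ?thesis by simp
    next
      case False
      then have "\<alpha> powr 0 \<le> \<alpha> powr (- (real j * t0))"
        using \<alpha> t0 by (intro powr_mono') auto
      then show ?thesis using \<alpha> by simp
    qed
    then have "\<kappa> * min 1 (\<alpha> powr (- real k * t0)) * \<alpha> powr (- s) * opnorm X
        \<le> \<kappa> * \<alpha> powr (- (real j * t0)) * \<alpha> powr (- s) * opnorm X"
      using \<kappa> Xpos by (intro mult_right_mono mult_left_mono) auto
    with large have "2 \<le> \<kappa> * (\<alpha> powr (- (real j * t0)) * \<alpha> powr (- s)) * opnorm X"
      by (simp add: mult.assoc)
    also have "\<alpha> powr (- (real j * t0)) * \<alpha> powr (- s) = 1 / \<alpha> powr (s + real j * t0)"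
      using \<alpha> by (simp add: powr_minus powr_add field_simps)
    finally show ?thesis using \<alpha> by (simp add: field_simps)
  qed
  \<comment> \<open>The delays are not prescribed, so the induction keeps only bounds on the final
    time: the lower one drives \<open>u\<close> to infinity, the upper one limits the power of
    \<open>\<gamma>\<close> below.\<close>
  have chain: "\<exists>u\<in>T. \<exists>Z\<in>E u. real (Suc n) * s \<le> u \<and> u \<le> real (Suc n) * L \<and>
      2 ^ n * opnorm X * \<alpha> powr (u - s) \<le> opnorm Z" for n
  proof (induction n)
    case 0
    show ?case using s \<alpha> t0 by (intro bexI[of _ s] bexI[of _ X]) (auto simp: L_def)
  next
    case (Suc n)
    then obtain u Z where u: "u \<in> T" "Z \<in> E u" "real (Suc n) * s \<le> u" "u \<le> real (Suc n) * L"
      and Z: "2 ^ n * opnorm X * \<alpha> powr (u - s) \<le> opnorm Z" by blast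
    have u0: "0 < u" using u(3) s by (smt (verit) mult_pos_pos of_nat_0_less_iff zero_less_Suc)
    obtain j Z' where j: "j \<le> k" and Z': "Z' \<in> E (s + u + real j * t0)" "\<kappa> * opnorm X * opnorm Z \<le> opnorm Z'"
      using sup[OF s u(1) u0 u(2)] by blast
    have "2 ^ Suc n * opnorm X * \<alpha> powr ((s + u + real j * t0) - s)
        = (2 * \<alpha> powr (s + real j * t0)) * (2 ^ n * opnorm X * \<alpha> powr (u - s))"
      by (simp add: algebra_simps flip: powr_add)
    also have "\<dots> \<le> (\<kappa> * opnorm X) * opnorm Z"
      using gain[OF j] Z \<kappa> Xpos by (rule_tac mult_mono) auto
    also note Z'(2)
    finally have "2 ^ Suc n * opnorm X * \<alpha> powr ((s + u + real j * t0) - s) \<le> opnorm Z'" .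
    moreover have "real (Suc (Suc n)) * s \<le> s + u + real j * t0"
    proof -
      have "0 \<le> real j * t0" using t0 by simp
      then show ?thesis using u(3) by (simp add: algebra_simps)
    qed
    moreover have "real j * t0 \<le> real k * t0" using j t0 by (intro mult_right_mono) auto
    then have "s + u + real j * t0 \<le> real (Suc (Suc n)) * L"
      using u(4) by (simp add: algebra_simps L_def)
    moreover have "s + u + real j * t0 \<in> T" using shift_mem T_add s u by blast
    ultimately show ?case using Z'(1) by blast
  qed
  \<comment> \<open>Raised to \<open>real (Suc n) * L\<close>, \<open>\<gamma>\<close> gives
    \<open>2 powr ((real n + 1) / 2)\<close>, roughly the square root of the gain
    \<open>2 ^ n\<close> of the chain. A rate below \<open>\<alpha> * \<gamma>\<close> is therefore
    too small.\<close>
  define \<gamma> where "\<gamma> = 2 powr (1 / (2 * L))"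
  define c where "c = opnorm X * \<alpha> powr (- s)"
  have c: "0 < c" using Xpos \<alpha> by (simp add: c_def)
  have \<gamma>: "1 < \<gamma>" using L by (simp add: \<gamma>_def gr_one_powr)
  have "\<rho> < \<alpha> * \<gamma>" using \<rho> mult_strict_left_mono[OF \<gamma> \<alpha>] by simp
  then have "eventually (\<lambda>t. growth t powr (1 / t) < \<alpha> * \<gamma>) time_filter"
    using lim by (intro order_tendstoD)
  then obtain b where b: "\<And>t. b \<le> t \<Longrightarrow> t \<in> T \<Longrightarrow> growth t powr (1 / t) < \<alpha> * \<gamma>"
    by (auto simp: time_filter_def eventually_inf_principal eventually_at_top_linorder)
  have bound: "c * 2 ^ n \<le> 2 powr ((real n + 1) / 2)" if n: "b / s \<le> real n" for n
  proof -
    obtain u Z where u: "u \<in> T" "Z \<in> E u" "real (Suc n) * s \<le> u" "u \<le> real (Suc n) * L"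
      and Z: "2 ^ n * opnorm X * \<alpha> powr (u - s) \<le> opnorm Z" using chain by blast
    have u0: "0 < u" using u(3) s by (smt (verit) mult_pos_pos of_nat_0_less_iff zero_less_Suc)
    have "b \<le> u" using n u(3) s by (simp add: field_simps)
    then have "growth u powr (1 / u) < \<alpha> * \<gamma>" using b u by blast
    then have "(growth u powr (1 / u)) powr u \<le> (\<alpha> * \<gamma>) powr u" using u0 by (intro powr_mono2) auto
    then have "growth u \<le> \<alpha> powr u * \<gamma> powr u"
      using growth_nonneg[OF u(1) u0] u0 \<alpha> \<gamma> by (simp add: powr_powr powr_mult)
    moreover have "2 ^ n * opnorm X * \<alpha> powr (u - s) = \<alpha> powr u * (c * 2 ^ n)"
      using \<alpha> by (simp add: c_def powr_diff powr_minus field_simps)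
    ultimately have "\<alpha> powr u * (c * 2 ^ n) \<le> \<alpha> powr u * \<gamma> powr u"
      using Z opnorm_le_growth[OF u(1) u0 u(2)] by linarith
    then have "c * 2 ^ n \<le> \<gamma> powr u" using \<alpha> by simp
    also have "\<dots> \<le> \<gamma> powr (real (Suc n) * L)" using u \<gamma> by (intro powr_mono) auto
    also have "\<dots> = 2 powr (1 / (2 * L) * (real (Suc n) * L))" by (simp only: \<gamma>_def powr_powr)
    also have "1 / (2 * L) * (real (Suc n) * L) = (real n + 1) / 2" using L by (simp add: divide_simps)
    finally show ?thesis .
  qed
  \<comment> \<open>Squaring the bound at \<open>m\<close> yields
    \<open>c^2 * 2 ^ m \<le> 2\<close>, which \<open>m > 2 / c^2\<close> and
    \<open>m < 2 ^ m\<close> refute.\<close>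
  obtain m :: nat where "max (b / s) (2 / c^2) < real m"
    using reals_Archimedean2 by blast
  then have m: "b / s \<le> real m" "2 / c^2 < real m" by auto
  have "(c * 2 ^ m)^2 \<le> (2 powr ((real m + 1) / 2))^2"
    using bound[OF m(1)] c by (intro power_mono) auto
  also have "\<dots> = 2 powr (real m + 1)" by (simp add: power2_eq_square flip: powr_add)
  also have "\<dots> = 2 * 2 ^ m" by (simp add: powr_add powr_realpow)
  finally have "c^2 * 2 ^ m \<le> 2"
    by (simp add: power2_eq_square)
  moreover have "real m < 2 ^ m" by (rule of_nat_less_two_power)
  then have "2 / c^2 < 2 ^ m" using m(2) by linarith
  then have "2 < c^2 * 2 ^ m" using c by (simp add: field_simps)
  ultimately show False by simp
qed

text \<open>Both alternatives come from \<open>growth_rate_gt\<close>. For positive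
  \<open>\<rho>\<close> it is used with \<open>\<alpha> = \<rho>\<close>. For
  \<open>\<rho> = 0\<close>, a sufficiently small \<open>\<alpha>\<close> makes any nonzero element
  large enough to give a positive rate.\<close>

lemma growth_dichotomy:
  obtains \<rho> where "((\<lambda>t. growth t powr (1 / t)) \<longlongrightarrow> \<rho>) time_filter"
    "(0 < \<rho> \<and> (\<exists>B. \<forall>t\<in>T. 0 < t \<longrightarrow> (\<forall>X\<in>E t. opnorm X \<le> B * \<rho> powr t))) \<or>
     (\<rho> = 0 \<and> (\<forall>t\<in>T. 0 < t \<longrightarrow> (\<forall>X\<in>E t. opnorm X = 0)))"
proof -
  obtain \<rho> where \<rho>: "0 \<le> \<rho>" and lim: "((\<lambda>t. growth t powr (1 / t)) \<longlongrightarrow> \<rho>) time_filter"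
    using growth_rate_exists by blast
  obtain \<kappa> k where \<kappa>: "0 < \<kappa>" and sup:
    "\<And>s t X Y. \<lbrakk>s \<in> T; 0 < s; X \<in> E s; t \<in> T; 0 < t; Y \<in> E t\<rbrakk> \<Longrightarrow>
      \<exists>j\<le>k::nat. \<exists>Z\<in>E (s + t + real j * t0). \<kappa> * opnorm X * opnorm Y \<le> opnorm Z"
    using growth_supermult by blast
  have gt: "\<alpha> < \<rho>" if "0 < \<alpha>" "s \<in> T" "0 < s" "X \<in> E s"
    "2 \<le> \<kappa> * min 1 (\<alpha> powr (- real k * t0)) * \<alpha> powr (- s) * opnorm X" for \<alpha> s X
    by (rule growth_rate_gt[OF lim _ that \<kappa>]) (rule sup)
  show thesis
  proof (cases "\<rho> = 0")
    case False
    define m where "m = \<kappa> * min 1 (\<rho> powr (- real k * t0))"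
    have m: "0 < m" using False \<kappa> \<rho> by (simp add: m_def)
    have "opnorm X \<le> (2 / m) * \<rho> powr t" if "t \<in> T" "0 < t" "X \<in> E t" for t X
    proof -
      \<comment> \<open>Otherwise \<open>gt\<close> would give
        \<open>\<rho> < \<rho>\<close>.\<close>
      have "m * \<rho> powr (- t) * opnorm X < 2"
        using gt[of \<rho> t X] that False \<rho> unfolding m_def by fastforce
      then show ?thesis using m False \<rho> by (simp add: powr_minus field_simps)
    qed
    moreover have "0 < \<rho>" using False \<rho> by simp
    ultimately show thesis using that[of \<rho>] lim by blast
  next
    case True
    have "opnorm X = 0" if "t \<in> T" "0 < t" "X \<in> E t" for t X
    proof (rule ccontr)
      assume "opnorm X \<noteq> 0"
      then have X: "0 < opnorm X" using opnorm_nonneg[of X] by linarith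
      define c where "c = \<kappa> * opnorm X / 2"
      have c: "0 < c" using X \<kappa> by (simp add: c_def)
      \<comment> \<open>\<open>\<alpha> \<le> 1\<close> turns the minimum in \<open>gt\<close> into
        \<open>1\<close>, and \<open>\<alpha> powr t \<le> c\<close> makes the remaining product at
        least \<open>2\<close>.\<close>
      define \<alpha> where "\<alpha> = min 1 (c powr (1 / t))"
      have \<alpha>: "0 < \<alpha>" "\<alpha> \<le> 1" using c by (auto simp: \<alpha>_def)
      have "\<alpha> powr t \<le> (c powr (1 / t)) powr t" using \<alpha> that by (intro powr_mono2) (auto simp: \<alpha>_def)
      also have "\<dots> = c" using c that by (simp add: powr_powr)
      finally have 1: "\<alpha> powr t \<le> c" .
      have "\<alpha> powr 0 \<le> \<alpha> powr (- real k * t0)" using \<alpha> t0 by (intro powr_mono') auto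
      then have "min 1 (\<alpha> powr (- real k * t0)) = 1" using \<alpha> by simp
      then have "2 \<le> \<kappa> * min 1 (\<alpha> powr (- real k * t0)) * \<alpha> powr (- t) * opnorm X"
        using 1 \<alpha> by (simp add: c_def powr_minus field_simps)
      from gt[OF \<alpha>(1) that this] True \<alpha> show False by simp
    qed
    then show thesis using that[of \<rho>] lim True by blast
  qed
qed

end

section \<open>Construction of the norm\<close>

context pcone begin

definition dual_ball :: "(real^'n) set" where
  "dual_ball = {g. (\<forall>y\<in>K. 0 \<le> g \<bullet> y) \<and> norm g \<le> 1}"

text \<open>Nonnegative functionals are used to obtain monotonicity. The identity in
  \<open>W\<close> makes the supremum definite, boundedness of \<open>W\<close> makes it finite, and
  stability of \<open>W\<close> under right multiplication by normalised semigroup elements will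
  give extremality.\<close>

definition dual_norm :: "'n mat set \<Rightarrow> real^'n \<Rightarrow> real" where
  "dual_norm W x = (SUP p\<in>dual_ball \<times> W. \<bar>fst p \<bullet> (snd p *v x)\<bar>)"

context
  fixes W :: "'n mat set" and B :: real
  assumes one: "mat 1 \<in> W" and W_bdd: "\<forall>w\<in>W. opnorm w \<le> B" and W_pi: "W \<subseteq> pi_cone K"
begin

lemma dual_norm_upper:
  assumes "g \<in> dual_ball" "w \<in> W" shows "\<bar>g \<bullet> (w *v x)\<bar> \<le> dual_norm W x"
proof -
  have "bdd_above ((\<lambda>p. \<bar>fst p \<bullet> (snd p *v x)\<bar>) ` (dual_ball \<times> W))"
  proof (rule bdd_aboveI2)
    fix p assume p: "p \<in> dual_ball \<times> W"
    have "\<bar>fst p \<bullet> (snd p *v x)\<bar> \<le> norm (fst p) * norm (snd p *v x)" by (rule Cauchy_Schwarz_ineq2)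
    also have "\<dots> \<le> 1 * (B * norm x)"
      using p W_bdd norm_matrix_vector_le[of "snd p" x]
      by (intro mult_mono order_trans[OF norm_matrix_vector_le] mult_right_mono)
        (auto simp: dual_ball_def)
    finally show "\<bar>fst p \<bullet> (snd p *v x)\<bar> \<le> B * norm x" by simp
  qed
  from cSUP_upper[OF _ this, of "(g, w)"] assms show ?thesis by (simp add: dual_norm_def)
qed

lemma dual_norm_le:
  assumes "\<And>g w. g \<in> dual_ball \<Longrightarrow> w \<in> W \<Longrightarrow> \<bar>g \<bullet> (w *v x)\<bar> \<le> c"
  shows "dual_norm W x \<le> c"
proof -
  have "(0, mat 1) \<in> dual_ball \<times> W" using one by (auto simp: dual_ball_def)
  then show ?thesis unfolding dual_norm_def by (intro cSUP_least) (use assms in auto)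
qed

lemma dual_norm_is_norm: "is_norm (dual_norm W)"
  unfolding is_norm_def
proof (intro conjI allI)
  have zero: "0 \<in> dual_ball" by (auto simp: dual_ball_def)
  show nonneg: "0 \<le> dual_norm W x" for x using dual_norm_upper[OF zero one, of x] by simp
  show "dual_norm W x = 0 \<longleftrightarrow> x = 0" for x
  proof
    assume 0: "dual_norm W x = 0"
    show "x = 0"
    proof (rule dual_separation)
      fix g assume "\<And>y. y \<in> K \<Longrightarrow> 0 \<le> g \<bullet> y" "norm g \<le> 1"
      then have "g \<in> dual_ball" by (auto simp: dual_ball_def)
      from dual_norm_upper[OF this one, of x] 0 show "g \<bullet> x = 0" by simp
    qed
  next
    assume "x = 0"
    then have "dual_norm W x \<le> 0" by (intro dual_norm_le) auto
    then show "dual_norm W x = 0" using nonneg[of x] by simp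
  qed
  show "dual_norm W (x + y) \<le> dual_norm W x + dual_norm W y" for x y
  proof (rule dual_norm_le)
    fix g w assume gw: "g \<in> dual_ball" "w \<in> W"
    have "\<bar>g \<bullet> (w *v (x + y))\<bar> \<le> \<bar>g \<bullet> (w *v x)\<bar> + \<bar>g \<bullet> (w *v y)\<bar>"
      by (simp add: matrix_vector_right_distrib inner_add_right)
    then show "\<bar>g \<bullet> (w *v (x + y))\<bar> \<le> dual_norm W x + dual_norm W y"
      using dual_norm_upper[OF gw, of x] dual_norm_upper[OF gw, of y] by linarith
  qed
  have le: "dual_norm W (c *\<^sub>R x) \<le> \<bar>c\<bar> * dual_norm W x" for c x
    by (rule dual_norm_le)
      (auto simp: matrix_vector_mult_scaleR abs_mult intro!: mult_left_mono dual_norm_upper)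
  show "dual_norm W (c *\<^sub>R x) = \<bar>c\<bar> * dual_norm W x" for c x
  proof (cases "c = 0")
    case True
    then show ?thesis using le[of 0 x] nonneg[of 0] by simp
  next
    case False
    have "\<bar>c\<bar> * dual_norm W x \<le> dual_norm W (c *\<^sub>R x)"
      using le[of "inverse c" "c *\<^sub>R x"] False by (simp add: field_simps)
    with le[of c x] show ?thesis by simp
  qed
qed

text \<open>Each composition of \<open>g\<close> with a positive \<open>w\<close> is nonnegative and
  order preserving on \<open>K\<close>, so the absolute values drop out of the comparison.\<close>

lemma dual_norm_monotone: "monotone_norm K (dual_norm W)"
  unfolding monotone_norm_def
proof (intro allI impI)
  fix x y assume xy: "cone_ge K x y \<and> cone_ge K y 0"
  show "dual_norm W y \<le> dual_norm W x"
  proof (rule dual_norm_le)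
    fix g w assume gw: "g \<in> dual_ball" "w \<in> W"
    have "w *v (x - y) \<in> K" "w *v y \<in> K"
      using xy gw W_pi by (auto simp: cone_ge_def intro!: pi_mem)
    then have "0 \<le> g \<bullet> (w *v (x - y))" "0 \<le> g \<bullet> (w *v y)"
      using gw by (auto simp: dual_ball_def)
    then have "\<bar>g \<bullet> (w *v y)\<bar> \<le> \<bar>g \<bullet> (w *v x)\<bar>"
      by (simp add: matrix_vector_mult_diff_distrib inner_diff_right)
    also have "\<dots> \<le> dual_norm W x" by (rule dual_norm_upper[OF gw])
    finally show "\<bar>g \<bullet> (w *v y)\<bar> \<le> dual_norm W x" .
  qed
qed

end

end

text \<open>\<open>E\<close> is the exact semigroup and \<open>S\<close> the given family, between
  \<open>E\<close> and its closure at positive times. The norm is built from \<open>E\<close>, and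
  its estimates pass to \<open>S\<close> by limits. Elements at time \<open>0\<close> other than the
  identity are reached along the times \<open>1 / real (Suc n)\<close>.\<close>

lemma (in cone_semigroup) exists_extremal_norm:
  fixes S :: "real \<Rightarrow> 'n mat set"
  assumes T_nonneg: "\<And>t. t \<in> T \<Longrightarrow> 0 \<le> t"
    and E_S: "\<And>t. t \<in> T \<Longrightarrow> 0 < t \<Longrightarrow> E t \<subseteq> S t"
    and S_E: "\<And>t. t \<in> T \<Longrightarrow> 0 < t \<Longrightarrow> S t \<subseteq> closure (E t)"
    and S_0: "\<And>P. P \<in> S 0 \<Longrightarrow> P = mat 1 \<or>
      (\<exists>X. (\<forall>n. 1 / real (Suc n) \<in> T \<and> X n \<in> E (1 / real (Suc n))) \<and> X \<longlonglongrightarrow> P)"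
  shows "\<exists>v. is_norm v \<and> monotone_norm K v \<and> extremal_norm T S v"
proof -
  obtain \<rho> where lim: "((\<lambda>t. growth t powr (1 / t)) \<longlongrightarrow> \<rho>) time_filter"
    and dich: "(0 < \<rho> \<and> (\<exists>B. \<forall>t\<in>T. 0 < t \<longrightarrow> (\<forall>X\<in>E t. opnorm X \<le> B * \<rho> powr t))) \<or>
     (\<rho> = 0 \<and> (\<forall>t\<in>T. 0 < t \<longrightarrow> (\<forall>X\<in>E t. opnorm X = 0)))"
    using growth_dichotomy by blast
  have \<rho>: "0 \<le> \<rho>" using dich by auto
  \<comment> \<open>Passing to the closure does not change the supremum of the norms, so
    \<open>jsr T S\<close> is the growth rate of \<open>E\<close>.\<close>
  have sup_eq: "(SUP X\<in>S t. opnorm X) = growth t" if t: "t \<in> T" "0 < t" for t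
  proof (rule cSup_eq_non_empty)
    show "opnorm ` S t \<noteq> {}" using E_nonempty[OF t] E_S[OF t] by auto
    show "x \<le> growth t" if "x \<in> opnorm ` S t" for x
      using that S_E[OF t] opnorm_le_closure[OF opnorm_le_growth[OF t]] by auto
    show "growth t \<le> y" if "\<And>x. x \<in> opnorm ` S t \<Longrightarrow> x \<le> y" for y
      using that E_S[OF t] by (intro growth_le[OF t]) auto
  qed
  have "eventually (\<lambda>t. growth t powr (1 / t) = (SUP X\<in>S t. opnorm X) powr (1 / t)) time_filter"
    unfolding time_filter_def eventually_inf_principal
    by (intro eventually_mono[OF eventually_gt_at_top[of "0::real"]]) (auto simp: sup_eq)
  from Lim_transform_eventually[OF lim this] have jsr: "jsr T S = \<rho>"
    using tendsto_Lim[OF time_filter_nontrivial] unfolding jsr_def time_filter_def by blast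

  \<comment> \<open>For \<open>\<rho> = 0\<close> the factor \<open>1 / \<rho> powr t\<close> is
    \<open>0\<close> by the conventions for \<open>powr\<close> and division, so \<open>W\<close>
    then contains at most \<open>mat 1\<close> and \<open>0\<close>.\<close>
  define W where "W = insert (mat 1) {(1 / \<rho> powr t) *\<^sub>R X | t X. t \<in> T \<and> 0 < t \<and> X \<in> E t}"
  have one: "mat 1 \<in> W" by (simp add: W_def)
  have W_pi: "W \<subseteq> pi_cone K"
    using E_pi unfolding W_def pi_cone_def by (fastforce simp: scaleR_matrix_vector intro: scale_mem)
  have opnorm_scale: "opnorm (c *\<^sub>R X) = \<bar>c\<bar> * opnorm X" for c and X :: "'n mat"
    by (simp add: scaleR_matrix_vector onorm_scaleR)
  obtain B where W_bdd: "\<forall>w\<in>W. opnorm w \<le> B"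
  proof (cases "\<rho> = 0")
    case True
    show thesis
    proof (rule that[of "max 0 (opnorm (mat 1 :: 'n mat))"], rule ballI)
      fix w assume "w \<in> W"
      then have "w = mat 1 \<or> w = 0" by (auto simp: W_def True)
      moreover have "opnorm (0 :: 'n mat) \<le> 0" by (rule opnorm_le) simp
      ultimately show "opnorm w \<le> max 0 (opnorm (mat 1 :: 'n mat))"
        by (metis max.cobounded2 max.coboundedI1)
    qed
  next
    case False
    then obtain B where B: "\<And>t X. t \<in> T \<Longrightarrow> 0 < t \<Longrightarrow> X \<in> E t \<Longrightarrow> opnorm X \<le> B * \<rho> powr t"
      using dich by blast
    show thesis
    proof (rule that[of "max B (opnorm (mat 1 :: 'n mat))"], rule ballI)
      fix w assume "w \<in> W"
      then consider "w = mat 1" | t X where "w = (1 / \<rho> powr t) *\<^sub>R X" "t \<in> T" "0 < t" "X \<in> E t"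
        by (auto simp: W_def)
      then show "opnorm w \<le> max B (opnorm (mat 1 :: 'n mat))"
      proof cases
        case 2
        then have "opnorm w \<le> B" using B[of t X] False \<rho> by (simp add: opnorm_scale field_simps)
        then show ?thesis by simp
      qed simp
    qed
  qed
  note upper = dual_norm_upper[OF one W_bdd W_pi] and least = dual_norm_le[OF one W_bdd W_pi]
  let ?v = "dual_norm W"
  have norm: "is_norm ?v" by (rule dual_norm_is_norm[OF one W_bdd W_pi])
  then have v_nonneg: "0 \<le> ?v x" for x by (simp add: is_norm_def)
  have E_contr: "\<bar>g \<bullet> (w *v (X *v x))\<bar> \<le> \<rho> powr t * ?v x"
    if g: "g \<in> dual_ball" and w: "w \<in> W" and t: "t \<in> T" "0 < t" and X: "X \<in> E t" for g w t X x
  proof (cases "\<rho> = 0")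
    case True
    then have "opnorm X = 0" using dich t X by auto
    then have "X *v x = 0" using norm_matrix_vector_le[of X x] by simp
    then show ?thesis using v_nonneg by simp
  next
    case False
    \<comment> \<open>\<open>W\<close> absorbs normalised elements from the right, so a value in the
      supremum at \<open>X *v x\<close> is \<open>\<rho> powr t\<close> times one at
      \<open>x\<close>.\<close>
    have "(1 / \<rho> powr t) *\<^sub>R (w ** X) \<in> W"
    proof -
      consider "w = mat 1" | s Y where "w = (1 / \<rho> powr s) *\<^sub>R Y" "s \<in> T" "0 < s" "Y \<in> E s"
        using w by (auto simp: W_def)
      then show ?thesis
      proof cases
        case 2
        have "(1 / \<rho> powr t) *\<^sub>R (w ** X) = (1 / \<rho> powr (s + t)) *\<^sub>R (Y ** X)"
          by (simp add: 2 matrix_mult_scaleR powr_add mult.commute)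
        then show ?thesis using 2 E_mult[OF 2(2,3) t 2(4) X] T_add[of s t] t unfolding W_def
          by (auto intro!: exI[of _ "s + t"])
      qed (use t X in \<open>auto simp: W_def\<close>)
    qed
    from upper[OF g this, of x] False \<rho> show ?thesis
      by (simp add: scaleR_matrix_vector matrix_vector_mul_assoc field_simps)
  qed
  have lim_contr: "(\<lambda>n. \<bar>g \<bullet> (w *v (X n *v x))\<bar>) \<longlonglongrightarrow> \<bar>g \<bullet> (w *v (P *v x))\<bar>"
    if "X \<longlonglongrightarrow> P" for g x and w P :: "'n mat" and X
    by (intro tendsto_intros matrix_vector_tendsto that)
  have "?v (P *v x) \<le> rpow \<rho> t * ?v x" if t: "t \<in> T" and P: "P \<in> S t" for t P x
  proof (cases "t = 0")
    case False
    then have t': "0 < t" using T_nonneg[OF t] by simp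
    obtain X where X: "\<And>n. X n \<in> E t" "X \<longlonglongrightarrow> P"
      using S_E[OF t t'] P closure_sequential by blast
    have "?v (P *v x) \<le> \<rho> powr t * ?v x"
      by (rule least, rule LIMSEQ_le_const2[OF lim_contr[OF X(2)]]) (use E_contr X t t' in auto)
    then show ?thesis using False by (simp add: rpow_def)
  next
    case True
    have "?v (P *v x) \<le> ?v x"
    proof (cases "P = mat 1")
      case False
      then obtain X where X: "\<And>n. 1 / real (Suc n) \<in> T" "\<And>n. X n \<in> E (1 / real (Suc n))" "X \<longlonglongrightarrow> P"
        using S_0 P True by blast
      show ?thesis
      proof (rule least)
        fix g w assume gw: "g \<in> dual_ball" "w \<in> W"
        have le: "\<bar>g \<bullet> (w *v (X n *v x))\<bar> \<le> \<rho> powr (1 / real (Suc n)) * ?v x" for n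
          using X(1)[of n] X(2)[of n] by (intro E_contr gw) auto
        show "\<bar>g \<bullet> (w *v (P *v x))\<bar> \<le> ?v x"
        proof (cases "\<rho> = 0")
          case True
          with le v_nonneg[of x] show ?thesis
            by (intro LIMSEQ_le_const2[OF lim_contr[OF X(3)]]) auto
        next
          case False
          \<comment> \<open>The bounds at the approximating times tend to the factor
            \<open>1\<close> required at time \<open>0\<close>.\<close>
          have "(\<lambda>n. \<rho> powr (1 / real (Suc n)) * ?v x) \<longlonglongrightarrow> \<rho> powr 0 * ?v x"
            using False by (intro tendsto_intros LIMSEQ_Suc[OF lim_1_over_n]) auto
          from LIMSEQ_le[OF lim_contr[OF X(3)] this] le False \<rho> show ?thesis by auto
        qed
      qed
    qed simp
    then show ?thesis using True by (simp add: rpow_def)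
  qed
  then have "extremal_norm T S ?v" unfolding extremal_norm_def jsr using norm by blast
  then show ?thesis using norm dual_norm_monotone[OF one W_bdd W_pi] by blast
qed

section \<open>Absolute norms on simplicial cones\<close>

context pcone begin

text \<open>In the basis \<open>b\<close> the cone order is coordinatewise, so the least upper bound
  has the absolute values of the coordinates of \<open>x\<close>.\<close>

lemma simplicial_abs_exists:
  assumes "simplicial K"
  shows "\<exists>z. cone_ge K z x \<and> cone_ge K z (- x) \<and>
      (\<forall>w. cone_ge K w x \<and> cone_ge K w (- x) \<longrightarrow> cone_ge K w z)"
proof -
  obtain b :: "'n \<Rightarrow> real^'n" where b: "inj b" "independent (range b)"
    and K: "K = {(\<Sum>i\<in>UNIV. c i *\<^sub>R b i) | c. \<forall>i. c i \<ge> 0}"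
    using assms unfolding simplicial_def by blast
  have mem: "(\<Sum>i\<in>UNIV. c i *\<^sub>R b i) \<in> K" if "\<And>i. 0 \<le> c i" for c
    using that unfolding K by blast
  have memE: "\<exists>c. y = (\<Sum>i\<in>UNIV. c i *\<^sub>R b i) \<and> (\<forall>i. 0 \<le> c i)" if "y \<in> K" for y
    using that unfolding K by blast
  have unique: "c i = 0" if "(\<Sum>i\<in>UNIV. c i *\<^sub>R b i) = 0" for c i
  proof -
    have "(\<Sum>v\<in>range b. c (inv b v) *\<^sub>R v) = 0"
      using that b(1) by (simp add: sum.reindex)
    then have "c (inv b (b i)) = 0"
      by (intro independentD[OF b(2), of "range b" "\<lambda>v. c (inv b v)"]) auto
    then show ?thesis using b(1) by simp
  qed
  have "dim (range b) = CARD('n)"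
    using b by (simp add: dim_eq_card_independent card_image)
  then have "span (range b) = UNIV"
    using dim_eq_full[of "range b"] by simp
  then have "x \<in> span (range b)" by simp
  then obtain u where "x = (\<Sum>v\<in>range b. u v *\<^sub>R v)"
    by (subst (asm) span_finite) auto
  then have x: "x = (\<Sum>i\<in>UNIV. u (b i) *\<^sub>R b i)"
    using b(1) by (simp add: sum.reindex)
  define c where "c i = u (b i)" for i
  have x: "x = (\<Sum>i\<in>UNIV. c i *\<^sub>R b i)" using x by (simp add: c_def)
  define z where "z = (\<Sum>i\<in>UNIV. \<bar>c i\<bar> *\<^sub>R b i)"
  have "z - x = (\<Sum>i\<in>UNIV. (\<bar>c i\<bar> - c i) *\<^sub>R b i)" "z - (-x) = (\<Sum>i\<in>UNIV. (\<bar>c i\<bar> + c i) *\<^sub>R b i)"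
    by (simp_all add: x z_def scaleR_diff_left scaleR_add_left sum_subtractf sum.distrib)
  then have "cone_ge K z x" "cone_ge K z (-x)"
    unfolding cone_ge_def by (auto intro!: mem)
  moreover have "cone_ge K w z" if w: "cone_ge K w x" "cone_ge K w (- x)" for w
  proof -
    obtain d d' where d: "w - x = (\<Sum>i\<in>UNIV. d i *\<^sub>R b i)" "\<And>i. 0 \<le> d i"
      and d': "w - (-x) = (\<Sum>i\<in>UNIV. d' i *\<^sub>R b i)" "\<And>i. 0 \<le> d' i"
      using w memE[of "w - x"] memE[of "w - - x"] unfolding cone_ge_def by blast
    \<comment> \<open>Comparing coordinates links the two expansions of \<open>w\<close>. The
      coordinate of \<open>w - z\<close> is then \<open>d i\<close> or \<open>d' i\<close>,
      according to the sign of \<open>c i\<close>.\<close>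
    have "(\<Sum>i\<in>UNIV. (d' i - d i - 2 * c i) *\<^sub>R b i) = (w - (-x)) - (w - x) - 2 *\<^sub>R x"
      unfolding d(1) d'(1) by (simp add: x scaleR_diff_left sum_subtractf scaleR_sum_right)
    also have "\<dots> = 0" by (simp add: scaleR_2)
    finally have dc: "d' i = d i + 2 * c i" for i
      using unique[of "\<lambda>i. d' i - d i - 2 * c i" i] by simp
    have "w - z = (w - x) + x - z" by simp
    also have "\<dots> = (\<Sum>i\<in>UNIV. (d i + c i - \<bar>c i\<bar>) *\<^sub>R b i)"
      unfolding d(1) by (simp add: x z_def scaleR_diff_left scaleR_add_left sum_subtractf sum.distrib)
    also have "\<dots> \<in> K"
    proof (rule mem)
      show "0 \<le> d i + c i - \<bar>c i\<bar>" for i using d(2)[of i] d'(2)[of i] dc[of i] by linarith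
    qed
    finally show ?thesis by (simp add: cone_ge_def)
  qed
  ultimately show ?thesis by blast
qed

section \<open>The lattice absolute value\<close>

lemma cone_ge_antisym: "cone_ge K x y \<Longrightarrow> cone_ge K y x \<Longrightarrow> x = y"
  using pointed[of "x - y"] by (simp add: cone_ge_def)

lemma cone_ge_trans: "cone_ge K x y \<Longrightarrow> cone_ge K y z \<Longrightarrow> cone_ge K x z"
  using add_mem[of "x - y" "y - z"] by (simp add: cone_ge_def)

lemma abs_K_eqI:
  assumes "cone_ge K z x" "cone_ge K z (- x)"
    "\<And>w. cone_ge K w x \<Longrightarrow> cone_ge K w (- x) \<Longrightarrow> cone_ge K w z"
  shows "abs_K K x = z"
  unfolding abs_K_def using assms by (intro the_equality) (auto intro: cone_ge_antisym)

context assumes simp_K: "simplicial K" begin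

lemma abs_K_ge: "cone_ge K (abs_K K x) x" "cone_ge K (abs_K K x) (- x)"
  and abs_K_least: "cone_ge K w x \<Longrightarrow> cone_ge K w (- x) \<Longrightarrow> cone_ge K w (abs_K K x)"
proof -
  obtain z where z: "cone_ge K z x" "cone_ge K z (- x)"
      "\<And>w. cone_ge K w x \<Longrightarrow> cone_ge K w (- x) \<Longrightarrow> cone_ge K w z"
    using simplicial_abs_exists[OF simp_K, of x] by blast
  have "abs_K K x = z" using z by (rule abs_K_eqI)
  with z show "cone_ge K (abs_K K x) x" "cone_ge K (abs_K K x) (- x)"
    "cone_ge K w x \<Longrightarrow> cone_ge K w (- x) \<Longrightarrow> cone_ge K w (abs_K K x)" by auto
qed

lemma abs_K_nonneg: "cone_ge K (abs_K K x) 0"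
proof -
  \<comment> \<open>\<open>abs_K K x\<close> is the average of its two nonnegative differences from
    \<open>x\<close> and \<open>- x\<close>.\<close>
  have "(1/2) *\<^sub>R ((abs_K K x - x) + (abs_K K x - (- x))) \<in> K"
    using abs_K_ge[of x] by (intro scale_mem add_mem) (auto simp: cone_ge_def)
  then show ?thesis by (simp add: cone_ge_def flip: scaleR_2)
qed

lemma abs_K_of_nonneg: assumes "cone_ge K x 0" shows "abs_K K x = x"
proof (rule abs_K_eqI)
  show "cone_ge K x x" by (simp add: cone_ge_def zero_mem)
  show "cone_ge K x (- x)" using assms add_mem[of x x] by (simp add: cone_ge_def)
qed

lemma abs_K_triangle: "cone_ge K (abs_K K x + abs_K K y) (abs_K K (x + y))"
  using add_mem[of "abs_K K x - x" "abs_K K y - y"] add_mem[of "abs_K K x - - x" "abs_K K y - - y"]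
    abs_K_ge[of x] abs_K_ge[of y]
  by (intro abs_K_least) (auto simp: cone_ge_def algebra_simps)

lemma cone_ge_scale: "cone_ge K x y \<Longrightarrow> 0 \<le> c \<Longrightarrow> cone_ge K (c *\<^sub>R x) (c *\<^sub>R y)"
  using scale_mem[of "x - y" c] by (simp add: cone_ge_def scaleR_diff_right)

lemma abs_K_uminus: "abs_K K (- x) = abs_K K x"
  using abs_K_ge[of x] abs_K_least[of _ x] by (intro abs_K_eqI) auto

lemma abs_K_scale_pos: assumes "0 < c" shows "abs_K K (c *\<^sub>R x) = c *\<^sub>R abs_K K x"
proof (rule abs_K_eqI)
  show "cone_ge K (c *\<^sub>R abs_K K x) (c *\<^sub>R x)" "cone_ge K (c *\<^sub>R abs_K K x) (- (c *\<^sub>R x))"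
    using cone_ge_scale[OF abs_K_ge(1)[of x], of c] cone_ge_scale[OF abs_K_ge(2)[of x], of c] assms by auto
  fix w assume w: "cone_ge K w (c *\<^sub>R x)" "cone_ge K w (- (c *\<^sub>R x))"
  have "cone_ge K (inverse c *\<^sub>R w) (abs_K K x)"
    using cone_ge_scale[OF w(1), of "inverse c"] cone_ge_scale[OF w(2), of "inverse c"] assms
    by (intro abs_K_least) auto
  from cone_ge_scale[OF this, of c] show "cone_ge K w (c *\<^sub>R abs_K K x)" using assms by simp
qed

lemma abs_K_zero: "abs_K K 0 = 0"
  by (rule abs_K_of_nonneg) (simp add: cone_ge_def zero_mem)

lemma abs_K_scale: "abs_K K (c *\<^sub>R x) = \<bar>c\<bar> *\<^sub>R abs_K K x"
proof -
  consider "c = 0" | "c > 0" | "c < 0" by linarith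
  then show ?thesis
  proof cases
    case 3
    then have "abs_K K (c *\<^sub>R x) = abs_K K (\<bar>c\<bar> *\<^sub>R x)"
      using abs_K_uminus[of "c *\<^sub>R x"] by simp
    then show ?thesis using 3 abs_K_scale_pos[of "\<bar>c\<bar>"] by simp
  qed (auto simp: abs_K_zero abs_K_scale_pos)
qed

lemma abs_K_eq_0: assumes "abs_K K x = 0" shows "x = 0"
  using abs_K_ge[of x] pointed[of x] assms by (simp add: cone_ge_def)

text \<open>Composing \<open>v\<close> with \<open>abs_K K\<close> works because a positive
  \<open>P\<close> satisfies \<open>abs_K K (P *v x)\<close> below \<open>P *v abs_K K x\<close>, so
  monotonicity reduces extremality to that of \<open>v\<close>. On the cone \<open>abs_K K\<close>
  is the identity, which gives monotonicity, and absoluteness by idempotence.\<close>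

lemma absolute_extremal_norm:
  assumes pos: "\<forall>t\<in>T. S t \<subseteq> pi_cone K"
    and v: "is_norm v" "monotone_norm K v" "extremal_norm T S v"
  shows "\<exists>v. is_norm v \<and> monotone_norm K v \<and> extremal_norm T S v \<and> absolute_norm K v"
proof -
  let ?u = "\<lambda>x. v (abs_K K x)"
  have mono: "v y \<le> v x" if "cone_ge K x y" "cone_ge K y 0" for x y
    using v(2) that by (auto simp: monotone_norm_def)
  have v_add: "v (x + y) \<le> v x + v y" and v_scale: "v (c *\<^sub>R x) = \<bar>c\<bar> * v x"
    and v_0: "v x = 0 \<longleftrightarrow> x = 0" and v_nonneg: "0 \<le> v x" for x y c
    using v(1) unfolding is_norm_def by blast+
  have norm: "is_norm ?u"
    unfolding is_norm_def
  proof (intro conjI allI)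
    show "?u (x + y) \<le> ?u x + ?u y" for x y
      using mono[OF abs_K_triangle abs_K_nonneg] v_add order_trans by blast
  qed (auto simp: v_nonneg v_0 v_scale abs_K_scale abs_K_zero dest: abs_K_eq_0)
  moreover have "monotone_norm K ?u"
    unfolding monotone_norm_def
  proof (intro allI impI)
    fix x y assume xy: "cone_ge K x y \<and> cone_ge K y 0"
    then have "cone_ge K x 0" using cone_ge_trans by blast
    with xy show "?u y \<le> ?u x" using mono by (simp add: abs_K_of_nonneg)
  qed
  moreover have "?u (P *v x) \<le> rpow (jsr T S) t * ?u x" if t: "t \<in> T" "P \<in> S t" for t P x
  proof -
    have P: "P \<in> pi_cone K" using pos t by auto
    have "cone_ge K (P *v abs_K K x) (P *v x)" "cone_ge K (P *v abs_K K x) (- (P *v x))"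
      using pi_mem[OF P, of "abs_K K x - x"] pi_mem[OF P, of "abs_K K x + x"] abs_K_ge[of x]
      by (auto simp: cone_ge_def matrix_vector_mult_diff_distrib matrix_vector_right_distrib)
    then have "?u (P *v x) \<le> v (P *v abs_K K x)"
      by (intro mono abs_K_least abs_K_nonneg)
    also have "\<dots> \<le> rpow (jsr T S) t * ?u x"
      using v(3) t by (auto simp: extremal_norm_def)
    finally show ?thesis .
  qed
  then have "extremal_norm T S ?u" using norm by (auto simp: extremal_norm_def)
  moreover have "absolute_norm K ?u"
    by (simp add: absolute_norm_def abs_K_of_nonneg[OF abs_K_nonneg])
  ultimately show ?thesis by blast
qed

end

end

section \<open>Discrete time\<close>

lemma foldr_matrix_append:
  "foldr (**) (As @ Bs) (mat 1) = foldr (**) As (mat 1) ** foldr (**) Bs (mat 1 :: 'n::finite mat)"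
  by (induction As) (auto simp: matrix_mul_assoc)

lemma disc_set_mult: "X \<in> disc_set M k \<Longrightarrow> Y \<in> disc_set M l \<Longrightarrow> X ** Y \<in> disc_set M (k + l)"
  unfolding disc_set_def
proof clarify
  fix As Bs :: "'a mat list" assume "set As \<subseteq> M" "set Bs \<subseteq> M"
  then show "\<exists>Cs. foldr (**) As (mat 1) ** foldr (**) Bs (mat 1) = foldr (**) Cs (mat 1) \<and>
      length Cs = length As + length Bs \<and> set Cs \<subseteq> M"
    by (intro exI[of _ "As @ Bs"]) (simp del: foldr_append add: foldr_matrix_append)
qed

lemma disc_set_split:
  assumes "Z \<in> disc_set M (k + l)" shows "\<exists>X\<in>disc_set M k. \<exists>Y\<in>disc_set M l. Z = X ** Y"
proof -
  obtain As where As: "Z = foldr (**) As (mat 1)" "length As = k + l" "set As \<subseteq> M"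
    using assms by (auto simp: disc_set_def)
  have "Z = foldr (**) (take k As) (mat 1) ** foldr (**) (drop k As) (mat 1)"
    using foldr_matrix_append[of "take k As" "drop k As"] As by simp
  moreover have "set (take k As) \<subseteq> M" "set (drop k As) \<subseteq> M"
    using As by (meson order_trans set_take_subset set_drop_subset)+
  ultimately show ?thesis using As unfolding disc_set_def
    by (intro bexI[of _ "foldr (**) (take k As) (mat 1)"] bexI[of _ "foldr (**) (drop k As) (mat 1)"]) auto
qed

lemma opnorm_one_le: "opnorm (mat 1 :: 'n::finite mat) \<le> 1"
  by (rule opnorm_le) simp

lemma compact_opnorm_bound:
  fixes M :: "'n::finite mat set"
  assumes "compact M" obtains L where "1 \<le> L" "\<And>A. A \<in> M \<Longrightarrow> opnorm A \<le> L"
proof -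
  obtain b where b: "\<And>A. A \<in> M \<Longrightarrow> norm A \<le> b"
    using assms compact_imp_bounded bounded_iff by metis
  obtain C where C: "0 < C" "\<And>A :: 'n mat. opnorm A \<le> C * norm A" using opnorm_le_norm by blast
  show thesis
  proof (rule that[of "max 1 (C * b)"])
    fix A assume "A \<in> M"
    then have "C * norm A \<le> C * b" using b C by simp
    then show "opnorm A \<le> max 1 (C * b)" using C(2)[of A] by linarith
  qed simp
qed

lemma disc_set_bound:
  assumes L: "1 \<le> L" "\<And>A. A \<in> M \<Longrightarrow> opnorm A \<le> L" and X: "X \<in> disc_set M k"
  shows "opnorm X \<le> L ^ k"
proof -
  have "set As \<subseteq> M \<Longrightarrow> opnorm (foldr (**) As (mat 1)) \<le> L ^ length As" for As
  proof (induction As)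
    case Nil
    then show ?case using opnorm_one_le by simp
  next
    case (Cons A As)
    have "opnorm (A ** foldr (**) As (mat 1)) \<le> opnorm A * opnorm (foldr (**) As (mat 1))"
      by (rule opnorm_mult)
    also have "\<dots> \<le> L * L ^ length As"
      using Cons L opnorm_nonneg by (intro mult_mono) auto
    finally show ?case by simp
  qed
  then show ?thesis using X by (auto simp: disc_set_def)
qed

section \<open>Continuous time\<close>

text \<open>The continuous approximants and the exceptional null set are translated
  together.\<close>

lemma measurable_on_shift:
  fixes f :: "real \<Rightarrow> 'a::real_normed_vector"
  assumes "f measurable_on {a..b}" shows "(\<lambda>r. f (r + c)) measurable_on {a - c..b - c}"
proof -
  obtain N g where N: "negligible N" and g: "\<And>n. continuous_on UNIV (g n)"
    and lim: "\<And>x. x \<notin> N \<Longrightarrow> (\<lambda>n. g n x) \<longlonglongrightarrow> (if x \<in> {a..b} then f x else 0)"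
    using assms unfolding measurable_on_def by blast
  show ?thesis unfolding measurable_on_def
  proof (intro exI conjI allI impI)
    show "negligible ((+) (- c) ` N)" using N by (rule negligible_translation)
    show "continuous_on UNIV (\<lambda>x. g n (x + c))" for n
      by (intro continuous_on_compose2[OF g] continuous_intros) auto
    fix x assume "x \<notin> (+) (- c) ` N"
    then have "x + c \<notin> N" by force
    from lim[OF this] show "(\<lambda>n. g n (x + c)) \<longlonglongrightarrow> (if x \<in> {a - c..b - c} then f (x + c) else 0)"
      by (simp add: algebra_simps)
  qed
qed

lemma measurable_on_sub:
  assumes f: "f measurable_on S" and R: "R \<in> sets lebesgue" "R \<subseteq> S" shows "f measurable_on R"
proof -
  have "(\<lambda>x. if x \<in> R then if x \<in> S then f x else 0 else 0) measurable_on UNIV"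
    by (rule measurable_on_restrict[OF _ R(1)]) (simp only: measurable_on_UNIV f)
  also have "(\<lambda>x. if x \<in> R then if x \<in> S then f x else 0 else 0) = (\<lambda>x. if x \<in> R then f x else 0)"
    using R by (auto simp: fun_eq_iff)
  finally show ?thesis by (simp only: measurable_on_UNIV)
qed

lemma measurable_on_glue:
  fixes f g :: "real \<Rightarrow> 'a::euclidean_space"
  assumes f: "f measurable_on {0..t}" and g: "g measurable_on {0..s}" and st: "0 \<le> s" "0 \<le> t"
  shows "(\<lambda>r. if r \<le> t then f r else g (r - t)) measurable_on {0..s + t}"
proof -
  have "(\<lambda>r. g (r - t)) measurable_on {t..s + t}"
    using measurable_on_shift[OF g, of "- t"] by simp
  \<comment> \<open>The left endpoint is dropped so that the sum of the two pieces does not count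
    \<open>t\<close> twice.\<close>
  then have "(\<lambda>r. g (r - t)) measurable_on {t<..s + t}"
    by (rule measurable_on_sub) auto
  with f have "(\<lambda>r. (if r \<in> {0..t} then f r else 0) + (if r \<in> {t<..s + t} then g (r - t) else 0)) measurable_on UNIV"
    by (simp only: measurable_on_add measurable_on_UNIV)
  also have "(\<lambda>r. (if r \<in> {0..t} then f r else 0) + (if r \<in> {t<..s + t} then g (r - t) else 0))
     = (\<lambda>r. if r \<in> {0..s + t} then if r \<le> t then f r else g (r - t) else 0)"
    using st by auto
  finally show ?thesis by (simp only: measurable_on_UNIV)
qed

text \<open>Keeps the signal and the whole trajectory, which \<open>cont_set\<close> hides behind
  the final value.\<close>

definition fundamental :: "'n::finite mat set \<Rightarrow> real \<Rightarrow> (real \<Rightarrow> 'n mat) \<Rightarrow> (real \<Rightarrow> 'n mat) \<Rightarrow> bool" where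
  "fundamental M t \<sigma> \<Phi> \<longleftrightarrow> (\<forall>s\<in>{0..t}. \<sigma> s \<in> M) \<and> \<sigma> measurable_on {0..t} \<and>
      continuous_on {0..t} \<Phi> \<and>
      (\<forall>s\<in>{0..t}. ((\<lambda>r. \<sigma> r ** \<Phi> r) has_integral (\<Phi> s - mat 1)) {0..s})"

lemma cont_set_eq: "cont_set M t = {\<Phi> t | \<sigma> \<Phi>. fundamental M t \<sigma> \<Phi>}"
  by (simp add: cont_set_def fundamental_def)

lemma
  assumes "fundamental M t \<sigma> \<Phi>"
  shows fundamental_mem: "\<And>s. s \<in> {0..t} \<Longrightarrow> \<sigma> s \<in> M"
    and fundamental_measurable: "\<sigma> measurable_on {0..t}"
    and fundamental_continuous: "continuous_on {0..t} \<Phi>"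
    and fundamental_integral:
      "\<And>s. s \<in> {0..t} \<Longrightarrow> ((\<lambda>r. \<sigma> r ** \<Phi> r) has_integral (\<Phi> s - mat 1)) {0..s}"
  using assms unfolding fundamental_def by blast+

lemma fundamental_0: "fundamental M t \<sigma> \<Phi> \<Longrightarrow> 0 \<le> t \<Longrightarrow> \<Phi> 0 = mat 1"
proof -
  assume "fundamental M t \<sigma> \<Phi>" "0 \<le> t"
  then have "((\<lambda>r. \<sigma> r ** \<Phi> r) has_integral (\<Phi> 0 - mat 1)) {0}"
    unfolding fundamental_def by (metis atLeastAtMost_iff atLeastAtMost_singleton order_refl)
  from has_integral_unique[OF this has_integral_refl(2)] show ?thesis by simp
qed

lemma fundamental_restrict: "fundamental M t \<sigma> \<Phi> \<Longrightarrow> s \<le> t \<Longrightarrow> fundamental M s \<sigma> \<Phi>"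
  by (subst fundamental_def, intro conjI ballI)
    (auto intro: fundamental_mem fundamental_integral continuous_on_subset[OF fundamental_continuous]
      measurable_on_sub[OF fundamental_measurable])

lemma fundamental_interval:
  assumes F: "fundamental M t \<sigma> \<Phi>" and ab: "0 \<le> a" "a \<le> b" "b \<le> t"
  shows "((\<lambda>r. \<sigma> r ** \<Phi> r) has_integral (\<Phi> b - \<Phi> a)) {a..b}"
proof -
  let ?f = "\<lambda>r. \<sigma> r ** \<Phi> r"
  have a: "(?f has_integral (\<Phi> a - mat 1)) {0..a}" and b: "(?f has_integral (\<Phi> b - mat 1)) {0..b}"
    using fundamental_integral[OF F] ab by auto
  have "?f integrable_on {a..b}"
    by (rule integrable_subinterval_real[OF has_integral_integrable[OF b]]) (use ab in auto)
  then obtain i where i: "(?f has_integral i) {a..b}" by (rule integrable_integral[THEN that])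
  have "\<Phi> a - mat 1 + i = \<Phi> b - mat 1"
    using has_integral_unique[OF has_integral_combine[OF ab(1,2) a i] b] .
  then have "i = \<Phi> b - \<Phi> a" by (simp add: algebra_simps)
  with i show ?thesis by simp
qed

text \<open>The right factor acts first: its signal runs on \<open>{0..t}\<close>, then that of
  \<open>X\<close> shifted by \<open>t\<close>. The trajectory continues as the second solution
  times the value already reached.\<close>

lemma cont_set_mult:
  assumes st: "0 \<le> s" "0 \<le> t" and "X \<in> cont_set M s" "Y \<in> cont_set M t"
  shows "X ** Y \<in> cont_set M (s + t)"
proof -
  obtain \<sigma>1 \<Phi>1 \<sigma>2 \<Phi>2 where F1: "fundamental M t \<sigma>1 \<Phi>1" "Y = \<Phi>1 t"
    and F2: "fundamental M s \<sigma>2 \<Phi>2" "X = \<Phi>2 s"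
    using assms by (auto simp: cont_set_eq)
  define \<sigma> where "\<sigma> r = (if r \<le> t then \<sigma>1 r else \<sigma>2 (r - t))" for r
  define \<Phi> where "\<Phi> r = (if r \<le> t then \<Phi>1 r else \<Phi>2 (r - t) ** \<Phi>1 t)" for r
  have z: "\<Phi>2 0 = mat 1" using fundamental_0[OF F2(1)] st by simp
  have glue: "\<Phi> r = \<Phi>2 (r - t) ** \<Phi>1 t" if "t \<le> r" for r using that z by (auto simp: \<Phi>_def)
  have "fundamental M (s + t) \<sigma> \<Phi>"
    unfolding fundamental_def
  proof (intro conjI ballI)
    show "\<sigma> r \<in> M" if "r \<in> {0..s + t}" for r
      using that fundamental_mem[OF F1(1), of r] fundamental_mem[OF F2(1), of "r - t"] by (auto simp: \<sigma>_def)
    show "\<sigma> measurable_on {0..s + t}"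
      unfolding \<sigma>_def 
      by (intro measurable_on_glue fundamental_measurable[OF F1(1)] fundamental_measurable[OF F2(1)] st)
    show "continuous_on {0..s + t} \<Phi>"
      unfolding \<Phi>_def
    proof (rule continuous_on_cases_le)
      show "continuous_on {x \<in> {0..s + t}. x \<le> t} \<Phi>1"
        by (rule continuous_on_subset[OF fundamental_continuous[OF F1(1)]]) auto
      show "continuous_on {x \<in> {0..s + t}. t \<le> x} (\<lambda>r. \<Phi>2 (r - t) ** \<Phi>1 t)"
        by (intro bounded_linear.continuous_on[OF bounded_linear_matrix_right]
            continuous_on_compose2[OF fundamental_continuous[OF F2(1)]] continuous_intros) auto
    qed (auto simp: z intro: continuous_intros)
    fix r assume r: "r \<in> {0..s + t}"
    show "((\<lambda>r. \<sigma> r ** \<Phi> r) has_integral (\<Phi> r - mat 1)) {0..r}"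
    proof (cases "r \<le> t")
      case True
      have "((\<lambda>r. \<sigma>1 r ** \<Phi>1 r) has_integral (\<Phi>1 r - mat 1)) {0..r}"
        using r True by (intro fundamental_integral[OF F1(1)]) auto
      then show ?thesis using True
        by (subst has_integral_cong[where g = "\<lambda>r. \<sigma>1 r ** \<Phi>1 r"]) (auto simp: \<sigma>_def \<Phi>_def)
    next
      case False
      have "((\<lambda>r. \<sigma>1 r ** \<Phi>1 r) has_integral (\<Phi>1 t - mat 1)) {0..t}"
        using st by (intro fundamental_integral[OF F1(1)]) auto
      then have 1: "((\<lambda>r. \<sigma> r ** \<Phi> r) has_integral (\<Phi>1 t - mat 1)) {0..t}"
        by (subst has_integral_cong[where g = "\<lambda>r. \<sigma>1 r ** \<Phi>1 r"]) (auto simp: \<sigma>_def \<Phi>_def)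
      have "((\<lambda>r. \<sigma>2 r ** \<Phi>2 r) has_integral (\<Phi>2 (r - t) - mat 1)) {0..r - t}"
        using r False by (intro fundamental_integral[OF F2(1)]) auto
      from has_integral_linear[OF has_integral_shift_real_ivl[OF this, of "- t"] bounded_linear_matrix_right[of "\<Phi>1 t"]]
      have "((\<lambda>u. \<sigma>2 (u - t) ** \<Phi>2 (u - t) ** \<Phi>1 t) has_integral (\<Phi>2 (r - t) - mat 1) ** \<Phi>1 t) {t..r}"
        by (simp add: o_def)
      moreover have "(\<Phi>2 (r - t) - mat 1) ** \<Phi>1 t = \<Phi> r - \<Phi>1 t"
        using False by (simp add: \<Phi>_def linear_diff[OF bounded_linear.linear[OF bounded_linear_matrix_right]])
      ultimately have "((\<lambda>u. \<sigma>2 (u - t) ** \<Phi>2 (u - t) ** \<Phi>1 t) has_integral \<Phi> r - \<Phi>1 t) {t..r}" by simp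
      \<comment> \<open>At \<open>t\<close> itself the glued signal still has its first value; a
        single point does not affect the integral.\<close>
      then have 2: "((\<lambda>r. \<sigma> r ** \<Phi> r) has_integral \<Phi> r - \<Phi>1 t) {t..r}"
        by (rule has_integral_spike[of "{t}", rotated 2]) (auto simp: \<sigma>_def \<Phi>_def matrix_mul_assoc)
      from has_integral_combine[OF _ _ 1 2] st False show ?thesis by simp
    qed
  qed
  then have "\<Phi> (s + t) \<in> cont_set M (s + t)" unfolding cont_set_eq by blast
  moreover have "\<Phi> (s + t) = X ** Y" using glue[of "s + t"] st F1 F2 by simp
  ultimately show ?thesis by simp
qed

section \<open>Estimates and invertibility of the fundamental solution\<close>

lemma compact_mult_bound:
  fixes M :: "'n::finite mat set"
  assumes "compact M" obtains c where "0 < c" "\<And>A X :: 'n mat. A \<in> M \<Longrightarrow> norm (A ** X) \<le> c * norm X"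
proof -
  obtain b where b: "0 < b" "\<And>A. A \<in> M \<Longrightarrow> norm A \<le> b"
    using assms compact_imp_bounded bounded_pos by metis
  obtain C where C: "0 < C" "\<And>(A :: 'n mat) (X :: 'n mat). norm (A ** X) \<le> norm A * norm X * C"
    using matrix_mult_norm_bound by blast
  show thesis
  proof (rule that[of "b * C"])
    fix A X :: "'n mat" assume "A \<in> M"
    then have "norm A * norm X * C \<le> b * norm X * C"
      using b C by (intro mult_right_mono) auto
    then show "norm (A ** X) \<le> b * C * norm X" using C(2)[of A X] by (simp add: mult_ac)
  qed (use b C in simp)
qed

text \<open>The integrand has norm at most \<open>c * m\<close>. The right factor \<open>Z\<close>
  is the identity in the growth bound and a matrix made from a kernel vector in the proof of
  invertibility.\<close>

lemma fundamental_increment: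
  fixes Z :: "'n::finite mat"
  assumes F: "fundamental M t \<sigma> \<Phi>" and ab: "0 \<le> a" "a \<le> b" "b \<le> t"
    and c: "0 < c" "\<And>A X :: 'n mat. A \<in> M \<Longrightarrow> norm (A ** X) \<le> c * norm X"
    and m: "\<And>u. u \<in> {a..b} \<Longrightarrow> norm (\<Phi> u ** Z) \<le> m"
  shows "norm (\<Phi> b ** Z - \<Phi> a ** Z) \<le> c * m * (b - a)"
proof -
  have "0 \<le> m" using order_trans[OF norm_ge_zero m[of a]] ab by simp
  have "((\<lambda>r. \<sigma> r ** \<Phi> r ** Z) has_integral ((\<Phi> b - \<Phi> a) ** Z)) {a..b}"
    using has_integral_linear[OF fundamental_interval[OF F ab] bounded_linear_matrix_right[of Z]]
    by (simp add: o_def)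
  moreover have "(\<Phi> b - \<Phi> a) ** Z = \<Phi> b ** Z - \<Phi> a ** Z"
    by (rule linear_diff[OF bounded_linear.linear[OF bounded_linear_matrix_right]])
  ultimately have "((\<lambda>r. \<sigma> r ** \<Phi> r ** Z) has_integral (\<Phi> b ** Z - \<Phi> a ** Z)) (cbox a b)" by simp
  then have "norm (\<Phi> b ** Z - \<Phi> a ** Z) \<le> c * m * measure lborel (cbox a b)"
  proof (rule has_integral_bound[rotated])
    fix r assume r: "r \<in> cbox a b"
    then have "norm (\<sigma> r ** (\<Phi> r ** Z)) \<le> c * norm (\<Phi> r ** Z)"
      using ab by (intro c fundamental_mem[OF F]) auto
    also have "\<dots> \<le> c * m" using m r c by (intro mult_left_mono) auto
    finally show "norm (\<sigma> r ** \<Phi> r ** Z) \<le> c * m" by (simp add: matrix_mul_assoc)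
  qed (use c \<open>0 \<le> m\<close> in simp)
  then show ?thesis using ab by simp
qed

lemma fundamental_attains_max:
  fixes Z :: "'n::finite mat"
  assumes F: "fundamental M t \<sigma> \<Phi>" and ab: "0 \<le> a" "a \<le> b" "b \<le> t"
  obtains u where "u \<in> {a..b}" "\<And>r. r \<in> {a..b} \<Longrightarrow> norm (\<Phi> r ** Z) \<le> norm (\<Phi> u ** Z)"
proof -
  have "continuous_on {a..b} \<Phi>"
    using ab by (intro continuous_on_subset[OF fundamental_continuous[OF F]]) auto
  then have "continuous_on {a..b} (\<lambda>r. norm (\<Phi> r ** Z))"
    by (intro continuous_on_norm bounded_linear.continuous_on[OF bounded_linear_matrix_right])
  from continuous_attains_sup[OF _ _ this] ab that show thesis by auto
qed

text \<open>At a point where the norm is maximal, its distance from the zero value at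
  \<open>b\<close> is at most half that maximum on so short an interval. The maximum is therefore
  zero.\<close>

lemma fundamental_backward_zero:
  fixes Z :: "'n::finite mat"
  assumes F: "fundamental M t \<sigma> \<Phi>" and ab: "0 \<le> a" "a \<le> b" "b \<le> t"
    and c: "0 < c" "\<And>A X :: 'n mat. A \<in> M \<Longrightarrow> norm (A ** X) \<le> c * norm X"
    and small: "2 * c * (b - a) \<le> 1" and zero: "\<Phi> b ** Z = 0"
  shows "\<Phi> a ** Z = 0"
proof -
  obtain u where u: "u \<in> {a..b}" "\<And>r. r \<in> {a..b} \<Longrightarrow> norm (\<Phi> r ** Z) \<le> norm (\<Phi> u ** Z)"
    using fundamental_attains_max[OF F ab] by blast
  let ?m = "norm (\<Phi> u ** Z)"
  have "norm (\<Phi> b ** Z - \<Phi> u ** Z) \<le> c * ?m * (b - u)"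
    by (rule fundamental_increment[OF F _ _ _ c]) (use u ab in auto)
  also have "\<dots> \<le> c * ?m * (b - a)" using u c by (intro mult_left_mono) auto
  also have "\<dots> = (2 * c * (b - a)) * ?m / 2" by simp
  also have "\<dots> \<le> 1 * ?m / 2" using small by (intro divide_right_mono mult_right_mono) auto
  finally have "?m = 0" using zero by simp
  then show ?thesis using u(2)[of a] ab by simp
qed

text \<open>A kernel vector is carried backwards in short steps to time \<open>0\<close>, where the
  solution is the identity.\<close>

lemma fundamental_invertible:
  fixes M :: "'n::finite mat set"
  assumes F: "fundamental M t \<sigma> \<Phi>" and t: "0 \<le> t" and M: "compact M"
  shows "invertible (\<Phi> t)"
proof -
  obtain c where c: "0 < c" "\<And>A X :: 'n mat. A \<in> M \<Longrightarrow> norm (A ** X) \<le> c * norm X"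
    using compact_mult_bound[OF M] by blast
  have "x = 0" if x: "\<Phi> t *v x = 0" for x
  proof -
    \<comment> \<open>All columns equal \<open>x\<close>, so the matrix estimates apply to the
      vector.\<close>
    define Z where "Z = ((\<chi> i j. x $ i) :: 'n mat)"
    have mult: "(B ** Z) $ i $ j = (B *v x) $ i" for B :: "'n mat" and i j
      by (simp add: Z_def matrix_matrix_mult_def matrix_vector_mult_def)
    \<comment> \<open>The step \<open>1 / (2 * c)\<close> is the longest one that
      \<open>fundamental_backward_zero\<close> allows.\<close>
    define p where "p n = max 0 (t - real n / (2 * c))" for n
    have "\<Phi> (p n) ** Z = 0" for n
    proof (induction n)
      case 0
      then show ?case using x t mult[of "\<Phi> t"] by (simp add: p_def vec_eq_iff)
    next
      case (Suc n)
      have "real (Suc n) / (2 * c) = real n / (2 * c) + 1 / (2 * c)" "0 < 1 / (2 * c)" "0 \<le> real n / (2 * c)"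
        using c by (auto simp: add_divide_distrib)
      then have "p n - p (Suc n) \<le> 1 / (2 * c)" "p (Suc n) \<le> p n" "p n \<le> t" "0 \<le> p (Suc n)"
        using t unfolding p_def by linarith+
      then show ?case using c
        by (intro fundamental_backward_zero[OF F _ _ _ c _ Suc]) (auto simp: field_simps)
    qed
    moreover obtain n where "t * (2 * c) < real n" using reals_Archimedean2 by blast
    then have "p n = 0" using c by (simp add: p_def field_simps)
    ultimately have "Z = 0" using fundamental_0[OF F t] by (metis matrix_mul_lid)
    then show "x = 0" by (simp add: Z_def vec_eq_iff)
  qed
  then show ?thesis
    by (simp add: invertible_left_inverse matrix_left_invertible_ker)
qed

text \<open>The trajectory after time \<open>t\<close>, multiplied on the right by the inverse of
  its value at \<open>t\<close>, solves the shifted equation and starts at the identity.\<close>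

lemma cont_set_split:
  assumes M: "compact M" and st: "0 \<le> s" "0 \<le> t" and "Z \<in> cont_set M (s + t)"
  shows "\<exists>X\<in>cont_set M s. \<exists>Y\<in>cont_set M t. Z = X ** Y"
proof -
  obtain \<sigma> \<Phi> where F: "fundamental M (s + t) \<sigma> \<Phi>" "Z = \<Phi> (s + t)"
    using assms by (auto simp: cont_set_eq)
  have Ft: "fundamental M t \<sigma> \<Phi>" using F st by (auto intro: fundamental_restrict)
  obtain B where B: "\<Phi> t ** B = mat 1" "B ** \<Phi> t = mat 1"
    using fundamental_invertible[OF Ft st(2) M] by (auto simp: invertible_def)
  define \<Psi> where "\<Psi> r = \<Phi> (r + t) ** B" for r
  have "fundamental M s (\<lambda>r. \<sigma> (r + t)) \<Psi>"
    unfolding fundamental_def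
  proof (intro conjI ballI)
    show "\<sigma> (r + t) \<in> M" if "r \<in> {0..s}" for r using that st by (intro fundamental_mem[OF F(1)]) auto
    have "\<sigma> measurable_on {t..s + t}"
      using st by (intro measurable_on_sub[OF fundamental_measurable[OF F(1)]]) auto
    from measurable_on_shift[OF this, of t] show "(\<lambda>r. \<sigma> (r + t)) measurable_on {0..s}" by simp
    show "continuous_on {0..s} \<Psi>" unfolding \<Psi>_def using st
      by (intro bounded_linear.continuous_on[OF bounded_linear_matrix_right]
            continuous_on_compose2[OF fundamental_continuous[OF F(1)]] continuous_intros) auto
    fix r assume r: "r \<in> {0..s}"
    have "((\<lambda>u. \<sigma> u ** \<Phi> u) has_integral (\<Phi> (r + t) - \<Phi> t)) {t..r + t}"
      using fundamental_interval[OF F(1)] r st by auto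
    from has_integral_linear[OF has_integral_shift_real_ivl[OF this, of t] bounded_linear_matrix_right[of B]]
    have "((\<lambda>u. \<sigma> (u + t) ** \<Phi> (u + t) ** B) has_integral (\<Phi> (r + t) - \<Phi> t) ** B) {0..r}"
      by (simp add: o_def)
    moreover have "(\<Phi> (r + t) - \<Phi> t) ** B = \<Psi> r - mat 1"
      using linear_diff[OF bounded_linear.linear[OF bounded_linear_matrix_right[of B]]] B(1)
      by (simp add: \<Psi>_def)
    ultimately show "((\<lambda>r. \<sigma> (r + t) ** \<Psi> r) has_integral \<Psi> r - mat 1) {0..r}"
      by (simp add: \<Psi>_def matrix_mul_assoc)
  qed
  then have "\<Psi> s \<in> cont_set M s" "\<Phi> t \<in> cont_set M t" using Ft unfolding cont_set_eq by blast+
  moreover have "Z = \<Psi> s ** \<Phi> t" using B(2) F(2) by (simp add: \<Psi>_def flip: matrix_mul_assoc)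
  ultimately show ?thesis by blast
qed

text \<open>On intervals of length \<open>h = 1 / (2 * c)\<close> the maximal norm is at most that
  of the identity plus half of itself. Longer times are cut into such pieces by
  \<open>cont_set_split\<close>.\<close>

lemma cont_set_bound:
  fixes M :: "'n::finite mat set"
  assumes M: "compact M"
  shows "\<exists>B. \<forall>t. 0 < t \<longrightarrow> t \<le> b \<longrightarrow> (\<forall>X\<in>cont_set M t. opnorm X \<le> B)"
proof -
  obtain c where c: "0 < c" "\<And>A X :: 'n mat. A \<in> M \<Longrightarrow> norm (A ** X) \<le> c * norm X"
    using compact_mult_bound[OF M] by blast
  obtain C where C: "0 < C" "\<And>A :: 'n mat. opnorm A \<le> C * norm A" using opnorm_le_norm by blast
  define h where "h = 1 / (2 * c)"
  have h: "0 < h" using c by (simp add: h_def)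
  define L where "L = max 1 (C * (2 * norm (mat 1 :: 'n mat)))"
  have short: "opnorm X \<le> L" if t: "0 \<le> t" "t \<le> h" and X: "X \<in> cont_set M t" for X t
  proof -
    obtain \<sigma> \<Phi> where F: "fundamental M t \<sigma> \<Phi>" "X = \<Phi> t" using X by (auto simp: cont_set_eq)
    obtain u where u: "u \<in> {0..t}" "\<And>r. r \<in> {0..t} \<Longrightarrow> norm (\<Phi> r ** mat 1) \<le> norm (\<Phi> u ** mat 1)"
      using fundamental_attains_max[OF F(1), of 0 t "mat 1"] t by auto
    have "norm (\<Phi> u ** mat 1 - \<Phi> 0 ** mat 1) \<le> c * norm (\<Phi> u ** mat 1) * (u - 0)"
      by (rule fundamental_increment[OF F(1) _ _ _ c]) (use u t in auto)
    also have "\<dots> \<le> c * norm (\<Phi> u) * h" using u c t by simp (intro mult_left_mono, auto)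
    also have "\<dots> = norm (\<Phi> u) / 2" using c by (simp add: h_def)
    finally have "norm (\<Phi> u - mat 1) \<le> norm (\<Phi> u) / 2" using fundamental_0[OF F(1)] t by simp
    then have "norm (\<Phi> u) \<le> 2 * norm (mat 1 :: 'n mat)"
      using norm_triangle_ineq2[of "\<Phi> u" "mat 1"] by linarith
    then have "norm X \<le> 2 * norm (mat 1 :: 'n mat)" using u(2)[of t] t F(2) by auto
    then have "C * norm X \<le> C * (2 * norm (mat 1 :: 'n mat))" using C(1) by simp
    then show ?thesis using C(2)[of X] by (simp add: L_def)
  qed
  have L: "1 \<le> L" by (simp add: L_def)
  have long: "\<forall>t X. 0 \<le> t \<longrightarrow> t \<le> real (Suc n) * h \<longrightarrow> X \<in> cont_set M t \<longrightarrow> opnorm X \<le> L ^ Suc n" for n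
  proof (induction n)
    case 0
    then show ?case by (auto intro: short)
  next
    case (Suc n)
    show ?case
    proof (intro allI impI)
      fix t X assume t: "0 \<le> t" "t \<le> real (Suc (Suc n)) * h" and X: "X \<in> cont_set M t"
      show "opnorm X \<le> L ^ Suc (Suc n)"
      proof (cases "t \<le> h")
        case True
        then have "opnorm X \<le> L ^ 1" using short t X by simp
        also have "\<dots> \<le> L ^ Suc (Suc n)" using L by (intro power_increasing) auto
        finally show ?thesis .
      next
        case False
        then obtain Y Z where YZ: "Y \<in> cont_set M h" "Z \<in> cont_set M (t - h)" "X = Y ** Z"
          using cont_set_split[OF M, of h "t - h" X] X h by auto
        have "opnorm X \<le> opnorm Y * opnorm Z" unfolding YZ by (rule opnorm_mult)
        also have "\<dots> \<le> L * L ^ Suc n"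
        proof (intro mult_mono)
          show "opnorm Y \<le> L" using short[OF _ _ YZ(1)] h by simp
          have "t - h \<le> real (Suc n) * h" using t by (simp add: algebra_simps)
          then show "opnorm Z \<le> L ^ Suc n"
            using Suc[rule_format, OF _ _ YZ(2)] False by simp
        qed (use L opnorm_nonneg in auto)
        finally show ?thesis by simp
      qed
    qed
  qed
  obtain n where "b / h < real n" using reals_Archimedean2 by blast
  then have "b \<le> real (Suc n) * h" using h by (simp add: field_simps)
  then show ?thesis using long[of n] by (intro exI[of _ "L ^ Suc n"]) (metis less_imp_le order_trans)
qed

section \<open>Matrix exponential\<close>

lemma mat_pow_scaleR: "mat_pow (s *\<^sub>R A) k = s ^ k *\<^sub>R mat_pow A k"
  by (induction k) (auto simp: matrix_mult_scaleR)

lemma mat_pow_add: "mat_pow A p ** mat_pow A q = mat_pow A (p + q)"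
  by (induction p) (simp_all flip: matrix_mul_assoc)

lemma mat_pow_commute: "A ** P = P ** A \<Longrightarrow> mat_pow A k ** P = P ** mat_pow A k"
proof (induction k)
  case (Suc k)
  have "mat_pow A (Suc k) ** P = A ** (mat_pow A k ** P)" by (simp add: matrix_mul_assoc)
  also have "\<dots> = (A ** P) ** mat_pow A k" using Suc by (simp add: matrix_mul_assoc)
  finally show ?case using Suc.prems by (simp add: matrix_mul_assoc)
qed simp

text \<open>Termwise comparison with a scalar exponential series; both convergence and closeness to
  the identity follow from it.\<close>

lemma mat_exp_majorant:
  obtains C where "0 < C"
    "\<And>(A :: 'n::finite mat) k. norm ((1 / fact k) *\<^sub>R mat_pow A k) \<le> norm (mat 1 :: 'n mat) * ((C * norm A) ^ k / fact k)"
proof -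
  obtain C where C: "0 < C" "\<And>(A :: 'n mat) (X :: 'n mat). norm (A ** X) \<le> norm A * norm X * C"
    using matrix_mult_norm_bound by blast
  have "norm (mat_pow A k) \<le> norm (mat 1 :: 'n mat) * (C * norm A) ^ k" for A :: "'n mat" and k
  proof (induction k)
    case (Suc k)
    have "norm (A ** mat_pow A k) \<le> C * norm A * norm (mat_pow A k)" using C(2)[of A "mat_pow A k"] by (simp add: mult_ac)
    also have "\<dots> \<le> C * norm A * (norm (mat 1 :: 'n mat) * (C * norm A) ^ k)"
      using C Suc by (intro mult_left_mono) auto
    finally show ?case by (simp add: mult_ac)
  qed simp
  then have "norm ((1 / fact k) *\<^sub>R mat_pow A k) \<le> norm (mat 1 :: 'n mat) * ((C * norm A) ^ k / fact k)"
    for A :: "'n mat" and k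
    by (simp add: divide_right_mono)
  with C(1) show thesis by (rule that)
qed

lemma exp_majorant_sums: "(\<lambda>k. b * (x ^ k / fact k)) sums (b * exp x)" for x b :: real
  using exp_converges[of x] by (intro sums_mult) (simp add: divide_inverse mult.commute)

lemma mat_exp_summable_norm: "summable (\<lambda>k. norm ((1 / fact k) *\<^sub>R mat_pow A k))"
  for A :: "'n::finite mat"
proof -
  obtain C where "\<And>(A :: 'n mat) k. norm ((1 / fact k) *\<^sub>R mat_pow A k) \<le> norm (mat 1 :: 'n mat) * ((C * norm A) ^ k / fact k)"
    using mat_exp_majorant by metis
  then show ?thesis
    by (intro summable_comparison_test'[OF sums_summable[OF exp_majorant_sums], of 0]) simp
qed

lemma mat_exp_sums: "(\<lambda>k. (1 / fact k) *\<^sub>R mat_pow A k) sums mat_exp A"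
  unfolding mat_exp_def by (rule summable_sums[OF summable_norm_cancel[OF mat_exp_summable_norm]])

lemma mat_exp_near_one:
  obtains C where "0 < C"
    "\<And>A :: 'n::finite mat. norm (mat_exp A - mat 1) \<le> norm (mat 1 :: 'n mat) * (exp (C * norm A) - 1)"
proof -
  obtain C where C: "0 < C" "\<And>(A :: 'n mat) k. norm ((1 / fact k) *\<^sub>R mat_pow A k) \<le> norm (mat 1 :: 'n mat) * ((C * norm A) ^ k / fact k)"
    using mat_exp_majorant by metis
  have "norm (mat_exp A - mat 1) \<le> norm (mat 1 :: 'n mat) * (exp (C * norm A) - 1)" for A :: "'n mat"
  proof -
    let ?b = "norm (mat 1 :: 'n mat)"
    have 1: "(\<lambda>k. (1 / fact (Suc k)) *\<^sub>R mat_pow A (Suc k)) sums (mat_exp A - mat 1)"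
      using mat_exp_sums[of A] by (subst sums_Suc_iff) simp
    have 2: "(\<lambda>k. ?b * ((C * norm A) ^ Suc k / fact (Suc k))) sums (?b * exp (C * norm A) - ?b)"
      using exp_majorant_sums[of ?b "C * norm A"] by (subst sums_Suc_iff) simp
    have "norm (\<Sum>k. (1 / fact (Suc k)) *\<^sub>R mat_pow A (Suc k)) \<le> (\<Sum>k. ?b * ((C * norm A) ^ Suc k / fact (Suc k)))"
      by (intro norm_suminf_le sums_summable[OF 2] C(2))
    then show ?thesis using sums_unique[OF 1] sums_unique[OF 2] by (simp add: right_diff_distrib)
  qed
  with C(1) show thesis by (rule that)
qed

lemma mat_exp_tendsto_one:
  fixes A :: "'n::finite mat"
  assumes "x \<longlonglongrightarrow> 0" shows "(\<lambda>n. mat_exp (x n *\<^sub>R A)) \<longlonglongrightarrow> mat 1"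
proof -
  obtain C where C: "0 < C"
    "\<And>A :: 'n::finite mat. norm (mat_exp A - mat 1) \<le> norm (mat 1 :: 'n mat) * (exp (C * norm A) - 1)"
    using mat_exp_near_one by blast
  have "(\<lambda>n. norm (mat 1 :: 'n mat) * (exp (C * norm (x n *\<^sub>R A)) - 1)) \<longlonglongrightarrow>
      norm (mat 1 :: 'n mat) * (exp (C * norm (0 *\<^sub>R A)) - 1)"
    by (intro tendsto_intros assms)
  then have "(\<lambda>n. norm (mat 1 :: 'n mat) * (exp (C * norm (x n *\<^sub>R A)) - 1)) \<longlonglongrightarrow> 0" by simp
  then have "(\<lambda>n. mat_exp (x n *\<^sub>R A) - mat 1) \<longlonglongrightarrow> 0"
    by (rule Lim_null_comparison[OF eventuallyI[OF C(2)]])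
  then show ?thesis by (simp add: LIM_zero_cancel)
qed

lemma mat_exp_zero: "mat_exp (0 :: 'n::finite mat) = mat 1"
proof -
  obtain C where "\<And>A :: 'n::finite mat. norm (mat_exp A - mat 1) \<le> norm (mat 1 :: 'n mat) * (exp (C * norm A) - 1)"
    using mat_exp_near_one by blast
  from this[of 0] show ?thesis by simp
qed

text \<open>In single entries the series become scalar, so that Cauchy products can be
  formed.\<close>

lemma mat_exp_component:
  shows "(\<lambda>k. (1 / fact k) *\<^sub>R mat_pow A k $ i $ j) sums (mat_exp A $ i $ j)"
    and "summable (\<lambda>k. norm ((1 / fact k) *\<^sub>R mat_pow A k $ i $ j))"
proof -
  have "bounded_linear (\<lambda>X :: 'a mat. X $ i $ j)"
    by (intro bounded_linear_compose[OF bounded_linear_vec_nth] bounded_linear_vec_nth)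
  from bounded_linear.sums[OF this mat_exp_sums[of A]]
  show "(\<lambda>k. (1 / fact k) *\<^sub>R mat_pow A k $ i $ j) sums (mat_exp A $ i $ j)" by simp
  have "norm (X $ i $ j) \<le> norm X" for X :: "'a mat"
    using Finite_Cartesian_Product.norm_nth_le[of X i]
      Finite_Cartesian_Product.norm_nth_le[of "X $ i" j] by linarith
  from this[of "(1 / fact k) *\<^sub>R mat_pow A k" for k]
  have "norm ((1 / fact k) *\<^sub>R mat_pow A k $ i $ j) \<le> norm ((1 / fact k) *\<^sub>R mat_pow A k)" for k
    by simp
  then show "summable (\<lambda>k. norm ((1 / fact k) *\<^sub>R mat_pow A k $ i $ j))"
    by (intro summable_comparison_test'[OF mat_exp_summable_norm[of A], of 0]) simp
qed

text \<open>Entry by entry, the matrix product is a finite sum of Cauchy products. Exchanging the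
  sums joins the powers of \<open>A\<close>, and the binomial formula for \<open>s\<close> and
  \<open>t\<close> collects the coefficients.\<close>

lemma mat_exp_add: "mat_exp (s *\<^sub>R A) ** mat_exp (t *\<^sub>R A) = mat_exp ((s + t) *\<^sub>R A)"
proof -
  have "(mat_exp (s *\<^sub>R A) ** mat_exp (t *\<^sub>R A)) $ i $ j = mat_exp ((s + t) *\<^sub>R A) $ i $ j" for i j
  proof -
    let ?a = "\<lambda>u i j k. (1 / fact k) *\<^sub>R mat_pow (u *\<^sub>R A) k $ i $ j"
    have "(\<lambda>n. \<Sum>p\<le>n. ?a s i l p * ?a t l j (n - p)) sums (mat_exp (s *\<^sub>R A) $ i $ l * mat_exp (t *\<^sub>R A) $ l $ j)" for l
      using Cauchy_product_sums[OF mat_exp_component(2)[of "s *\<^sub>R A" i l] mat_exp_component(2)[of "t *\<^sub>R A" l j]]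
      by (simp only: sums_unique[OF mat_exp_component(1), symmetric])
    then have "(\<lambda>n. \<Sum>l\<in>UNIV. \<Sum>p\<le>n. ?a s i l p * ?a t l j (n - p)) sums
        (\<Sum>l\<in>UNIV. mat_exp (s *\<^sub>R A) $ i $ l * mat_exp (t *\<^sub>R A) $ l $ j)"
      by (intro sums_sum) auto
    moreover have "(\<Sum>l\<in>UNIV. \<Sum>p\<le>n. ?a s i l p * ?a t l j (n - p)) = ?a (s + t) i j n" for n
    proof -
      have "(\<Sum>l\<in>UNIV. \<Sum>p\<le>n. ?a s i l p * ?a t l j (n - p))
          = (\<Sum>p\<le>n. (s ^ p /\<^sub>R fact p) * (t ^ (n - p) /\<^sub>R fact (n - p)) *
              (\<Sum>l\<in>UNIV. mat_pow A p $ i $ l * mat_pow A (n - p) $ l $ j))"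
        by (subst sum.swap) (simp add: mat_pow_scaleR sum_distrib_left field_simps)
      also have "\<dots> = (\<Sum>p\<le>n. (s ^ p /\<^sub>R fact p) * (t ^ (n - p) /\<^sub>R fact (n - p)) * mat_pow A n $ i $ j)"
      proof (rule sum.cong)
        fix p assume "p \<in> {..n}"
        then have "mat_pow A p ** mat_pow A (n - p) = mat_pow A n" by (simp add: mat_pow_add)
        then have "(\<Sum>l\<in>UNIV. mat_pow A p $ i $ l * mat_pow A (n - p) $ l $ j) = mat_pow A n $ i $ j"
          by (simp add: matrix_matrix_mult_def vec_eq_iff)
        then show "(s ^ p /\<^sub>R fact p) * (t ^ (n - p) /\<^sub>R fact (n - p)) *
              (\<Sum>l\<in>UNIV. mat_pow A p $ i $ l * mat_pow A (n - p) $ l $ j) =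
            (s ^ p /\<^sub>R fact p) * (t ^ (n - p) /\<^sub>R fact (n - p)) * mat_pow A n $ i $ j" by simp
      qed simp
      also have "\<dots> = ((s + t) ^ n /\<^sub>R fact n) * mat_pow A n $ i $ j"
        by (subst exp_series_add_commuting) (simp_all add: sum_distrib_right)
      finally show ?thesis by (simp add: mat_pow_scaleR divide_inverse)
    qed
    ultimately have "?a (s + t) i j sums (\<Sum>l\<in>UNIV. mat_exp (s *\<^sub>R A) $ i $ l * mat_exp (t *\<^sub>R A) $ l $ j)" by simp
    from sums_unique2[OF this mat_exp_component(1)] show ?thesis by (simp add: matrix_matrix_mult_def)
  qed
  then show ?thesis by (simp add: vec_eq_iff)
qed

lemma mat_exp_commute:
  fixes A P :: "'n::finite mat"
  assumes "A ** P = P ** A" shows "mat_exp A ** P = P ** mat_exp A"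
proof -
  have "(\<lambda>k. ((1 / fact k) *\<^sub>R mat_pow A k) ** P) sums (mat_exp A ** P)"
    by (rule bounded_linear.sums[OF bounded_linear_matrix_right mat_exp_sums])
  moreover have "(\<lambda>k. P ** ((1 / fact k) *\<^sub>R mat_pow A k)) sums (P ** mat_exp A)"
    by (rule bounded_linear.sums[OF bounded_linear_matrix_left mat_exp_sums])
  ultimately show ?thesis
    using mat_pow_commute[OF assms] by (simp add: matrix_mult_scaleR sums_unique2)
qed

section \<open>Switching with jumps\<close>

text \<open>In \<^const>\<open>jump_set\<close> the last segment may have length zero, so that concatenation can leave
  the family. Requiring every segment to have positive length gives an exact semigroup with the
  same closure.\<close>
inductive jump_word :: "('n::finite mat \<times> 'n mat) set \<Rightarrow> real \<Rightarrow> 'n mat \<Rightarrow> bool" for M where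
  empty: "jump_word M 0 (mat 1)"
| step: "jump_word M t Y \<Longrightarrow> (A, P) \<in> M \<Longrightarrow> 0 < \<tau> \<Longrightarrow>
    jump_word M (\<tau> + t) (mat_exp (\<tau> *\<^sub>R A) ** P ** Y)"

lemma jump_word_nonneg: "jump_word M t Y \<Longrightarrow> 0 \<le> t"
  by (induction rule: jump_word.induct) auto

lemma jump_word_0: "jump_word M 0 Y \<Longrightarrow> Y = mat 1"
  by (cases rule: jump_word.cases) (auto dest: jump_word_nonneg)

lemma jump_word_single: "(A, P) \<in> M \<Longrightarrow> 0 < \<tau> \<Longrightarrow> jump_word M \<tau> (mat_exp (\<tau> *\<^sub>R A) ** P)"
  using jump_word.step[OF jump_word.empty, of A P M \<tau>] by simp

lemma jump_word_mult:
  "jump_word M s X \<Longrightarrow> jump_word M t Y \<Longrightarrow> jump_word M (s + t) (X ** Y)"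
proof (induction rule: jump_word.induct)
  case (step s X A P \<tau>)
  then show ?case
    using jump_word.step[of M "s + t" "X ** Y" A P \<tau>] by (simp add: add.assoc matrix_mul_assoc)
qed simp

text \<open>Restarting the same mode inside a segment changes nothing: \<open>P\<close> moves past
  the exponential and \<open>P ** P\<close> collapses.\<close>

lemma jump_segment_merge:
  assumes "P ** P = P" "A ** P = P ** A"
  shows "mat_exp (s *\<^sub>R A) ** P ** (mat_exp (t *\<^sub>R A) ** P) = mat_exp ((s + t) *\<^sub>R A) ** P"
proof -
  have comm: "P ** mat_exp (t *\<^sub>R A) = mat_exp (t *\<^sub>R A) ** P"
    using assms by (intro mat_exp_commute[symmetric]) (simp add: matrix_mult_scaleR)
  have "mat_exp (s *\<^sub>R A) ** P ** (mat_exp (t *\<^sub>R A) ** P)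
      = mat_exp (s *\<^sub>R A) ** (P ** mat_exp (t *\<^sub>R A)) ** P" by (simp add: matrix_mul_assoc)
  also have "\<dots> = (mat_exp (s *\<^sub>R A) ** mat_exp (t *\<^sub>R A)) ** (P ** P)"
    unfolding comm by (simp add: matrix_mul_assoc)
  finally show ?thesis by (simp add: assms mat_exp_add)
qed

text \<open>Induction removes the latest segment, with \<open>s\<close> measured back from the final
  time.\<close>

lemma jump_word_split:
  assumes proj: "\<forall>(A, P)\<in>M. P ** P = P \<and> A ** P = P ** A"
  shows "jump_word M u Z \<Longrightarrow> u = s + t \<Longrightarrow> 0 \<le> s \<Longrightarrow> 0 \<le> t \<Longrightarrow>
    \<exists>X Y. jump_word M s X \<and> jump_word M t Y \<and> Z = X ** Y"
proof (induction arbitrary: s rule: jump_word.induct)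
  case empty
  then show ?case using jump_word.empty[of M]
    by (intro exI[of _ "mat 1"] conjI) (auto simp: add_nonneg_eq_0_iff)
next
  case (step t' Y' A P \<tau>)
  have merge: "mat_exp (s *\<^sub>R A) ** P ** (mat_exp ((\<tau> - s) *\<^sub>R A) ** P) = mat_exp (\<tau> *\<^sub>R A) ** P" for s
    using jump_segment_merge[of P A s "\<tau> - s"] proj step.hyps by auto
  \<comment> \<open>A cut strictly inside the latest segment splits it by \<open>merge\<close> into
    two segments of the same mode; a cut before that segment is left to the induction
    hypothesis.\<close>
  consider "s = 0" | "s = \<tau>" | "0 < s" "s < \<tau>" | "\<tau> < s" using step.prems by linarith
  then show ?case
  proof cases
    case 1
    then show ?thesis using jump_word.step[OF step.hyps(1-3)] step.prems jump_word.empty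
      by (intro exI[of _ "mat 1"] exI conjI) auto
  next
    case 2
    then show ?thesis using jump_word_single[OF step.hyps(2,3)] step
      by (intro exI[of _ "mat_exp (\<tau> *\<^sub>R A) ** P"] exI[of _ Y']) auto
  next
    case 3
    have "jump_word M (\<tau> - s + t') (mat_exp ((\<tau> - s) *\<^sub>R A) ** P ** Y')"
      using 3 step.hyps by (intro jump_word.step) auto
    moreover have "\<tau> - s + t' = t" using step.prems by simp
    moreover have "mat_exp (s *\<^sub>R A) ** P ** (mat_exp ((\<tau> - s) *\<^sub>R A) ** P ** Y') = mat_exp (\<tau> *\<^sub>R A) ** P ** Y'"
      using merge[of s] by (metis matrix_mul_assoc)
    ultimately show ?thesis using jump_word_single[OF step.hyps(2) 3(1)] by metis
  next
    case 4
    then obtain X Y where XY: "jump_word M (s - \<tau>) X" "jump_word M t Y" "Y' = X ** Y"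
      using step.IH[of "s - \<tau>"] step.prems by auto
    from jump_word.step[OF XY(1) step.hyps(2,3)] XY show ?thesis
      by (intro exI[of _ "mat_exp (\<tau> *\<^sub>R A) ** P ** X"] exI[of _ Y]) (auto simp: matrix_mul_assoc)
  qed
qed

section \<open>Words and switching signals\<close>

lemma jump_pre_cong:
  "(\<And>i. i \<le> k \<Longrightarrow> ts i = ts' i) \<Longrightarrow> (\<And>i. i < k \<Longrightarrow> p i = p' i) \<Longrightarrow> jump_pre ts p k = jump_pre ts' p' k"
  by (induction k) auto

lemma jump_word_jump_pre:
  assumes "ts 0 = 0" "strict_mono ts" "\<And>j. p j \<in> M"
  shows "jump_word M (ts k) (jump_pre ts p k)"
proof (induction k)
  case 0
  then show ?case using assms jump_word.empty by simp
next
  case (Suc k)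
  have "jump_word M (ts (Suc k) - ts k + ts k)
      (mat_exp ((ts (Suc k) - ts k) *\<^sub>R fst (p k)) ** snd (p k) ** jump_pre ts p k)"
    using assms strict_monoD[OF assms(2), of k "Suc k"] by (intro jump_word.step Suc) auto
  then show ?case by simp
qed

definition switching :: "('n::finite mat \<times> 'n mat) set \<Rightarrow> (nat \<Rightarrow> real) \<Rightarrow> (nat \<Rightarrow> 'n mat \<times> 'n mat) \<Rightarrow> bool" where
  "switching M ts p \<longleftrightarrow> ts 0 = 0 \<and> strict_mono ts \<and> filterlim ts at_top sequentially \<and> (\<forall>j. p j \<in> M)"

text \<open>\<open>jump_set\<close> asks for infinite signals, while a word is finite. Here the
  future after index \<open>k\<close> is rewritten: mode \<open>q\<close> until time
  \<open>r\<close>, then unit spacing so that the times still tend to infinity.\<close>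

lemma switching_extend:
  assumes S: "switching M ts p" and q: "q \<in> M" and r: "ts k < r"
  defines "ts' \<equiv> \<lambda>i. if i \<le> k then ts i else r + real (i - Suc k)" and "p' \<equiv> p(k := q)"
  shows "switching M ts' p'" "ts' k = ts k" "ts' (Suc k) = r" "p' k = q" "jump_pre ts' p' k = jump_pre ts p k"
proof -
  have "strict_mono ts'"
  proof (rule strict_monoI_Suc)
    fix n
    consider "n < k" | "n = k" | "k < n" by linarith
    then show "ts' n < ts' (Suc n)"
      using S r by cases (auto simp: ts'_def switching_def strict_mono_Suc_iff)
  qed
  moreover have "filterlim ts' at_top sequentially"
  proof (rule filterlim_at_top_mono)
    show "filterlim (\<lambda>i. real i + (r - real (Suc k))) at_top sequentially"
      using filterlim_tendsto_add_at_top[OF tendsto_const filterlim_real_sequentially, of "r - real (Suc k)"]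
      by (simp add: add.commute)
    show "eventually (\<lambda>i. real i + (r - real (Suc k)) \<le> ts' i) sequentially"
      using eventually_gt_at_top[of k] by eventually_elim (auto simp: ts'_def of_nat_diff)
  qed
  ultimately show "switching M ts' p'" using S q by (auto simp: switching_def ts'_def p'_def)
  show "ts' k = ts k" "ts' (Suc k) = r" "p' k = q" by (auto simp: ts'_def p'_def)
  show "jump_pre ts' p' k = jump_pre ts p k" by (rule jump_pre_cong) (auto simp: ts'_def p'_def)
qed

lemma jump_word_switching:
  assumes "jump_word M t Y" "M \<noteq> {}"
  shows "\<exists>ts p k. switching M ts p \<and> ts k = t \<and> jump_pre ts p k = Y"
  using assms
proof (induction rule: jump_word.induct)
  case empty
  then obtain q where "q \<in> M" by auto
  then have "switching M real (\<lambda>_. q)"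
    by (auto simp: switching_def strict_mono_def filterlim_real_sequentially)
  then show ?case by (intro exI[of _ real] exI[of _ "\<lambda>_. q"] exI[of _ 0]) auto
next
  case (step t Y A P \<tau>)
  then obtain ts p k where S: "switching M ts p" "ts k = t" "jump_pre ts p k = Y" by blast
  from switching_extend[OF S(1) step.hyps(2), of k "\<tau> + t"] step.hyps(3) S
  obtain ts' p' where "switching M ts' p'" "ts' k = t" "ts' (Suc k) = \<tau> + t" "p' k = (A, P)" "jump_pre ts' p' k = Y"
    by auto
  then show ?case by (intro exI[of _ ts'] exI[of _ p'] exI[of _ "Suc k"]) auto
qed

text \<open>Only the current segment may have length zero; all completed ones are positive and form
  a word.\<close>

lemma jump_set_eq:
  "jump_set M t = {mat_exp (\<tau> *\<^sub>R A) ** P ** Y | \<tau> A P Y t'. 0 \<le> \<tau> \<and> t = \<tau> + t' \<and> (A, P) \<in> M \<and> jump_word M t' Y}"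
    (is "_ = ?R")
proof (intro equalityI subsetI)
  fix X assume "X \<in> jump_set M t"
  then obtain ts p k where ts: "ts 0 = 0" "strict_mono ts" "\<And>j. p j \<in> M" "ts k \<le> t"
    and X: "X = mat_exp ((t - ts k) *\<^sub>R fst (p k)) ** snd (p k) ** jump_pre ts p k"
    by (auto simp: jump_set_def)
  have "0 \<le> t - ts k" "t = (t - ts k) + ts k" "(fst (p k), snd (p k)) \<in> M"
    using ts by auto
  with jump_word_jump_pre[of ts p M k, OF ts(1-3)] show "X \<in> ?R" unfolding X by blast
next
  fix X assume "X \<in> ?R"
  then obtain \<tau> A P Y t' where X: "X = mat_exp (\<tau> *\<^sub>R A) ** P ** Y" "0 \<le> \<tau>" "t = \<tau> + t'"
    and AP: "(A, P) \<in> M" and Y: "jump_word M t' Y" by auto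
  obtain ts p k where S: "switching M ts p" "ts k = t'" "jump_pre ts p k = Y"
    using jump_word_switching[OF Y] AP by blast
  \<comment> \<open>The next switching time \<open>t + 1\<close> serves only to lie after
    \<open>t\<close>.\<close>
  from switching_extend[OF S(1) AP, of k "t + 1"] S X
  obtain ts' p' where "switching M ts' p'" "ts' k = t'" "ts' (Suc k) = t + 1" "p' k = (A, P)" "jump_pre ts' p' k = Y"
    by auto
  then show "X \<in> jump_set M t" using X unfolding jump_set_def switching_def
    by (auto intro!: exI[of _ ts'] exI[of _ p'] exI[of _ k])
qed

lemma jump_word_in_jump_set:
  assumes "jump_word M t X" "0 < t" shows "X \<in> jump_set M t"
  using assms(1)
proof cases
  case (step t' Y A P \<tau>)
  then show ?thesis unfolding jump_set_eq using less_imp_le[OF step(5)] by blast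
qed (use assms in auto)

text \<open>A final segment of length zero is approximated by giving it a little time taken from the
  preceding segment.\<close>

lemma jump_set_in_closure:
  assumes "X \<in> jump_set M t" "0 < t" shows "X \<in> closure {Y. jump_word M t Y}"
proof -
  obtain \<tau> A P Y t' where X: "X = mat_exp (\<tau> *\<^sub>R A) ** P ** Y" "0 \<le> \<tau>" "t = \<tau> + t'"
    and AP: "(A, P) \<in> M" and Y: "jump_word M t' Y" using assms(1) unfolding jump_set_eq by auto
  show ?thesis
  proof (cases "\<tau> = 0")
    case False
    then have "jump_word M (\<tau> + t') (mat_exp (\<tau> *\<^sub>R A) ** P ** Y)"
      using X(2) AP Y by (intro jump_word.step) auto
    then have "X \<in> {Y. jump_word M t Y}" using X by simp
    then show ?thesis by (rule subsetD[OF closure_subset])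
  next
    case True
    from Y show ?thesis
    proof cases
      case empty
      then show ?thesis using True X assms by simp
    next
      case (step t'' Y' A' P' \<tau>')
      \<comment> \<open>The shift by \<open>2\<close> keeps \<open>x n < \<tau>'\<close> also for
        \<open>n = 0\<close>, so both segments stay positive.\<close>
      define x where "x n = \<tau>' / real (n + 2)" for n
      have x: "0 < x n" "x n < \<tau>'" for n using step by (auto simp: x_def field_simps add_pos_nonneg)
      have "(\<lambda>n. \<tau>' * (1 / real (n + 2))) \<longlonglongrightarrow> \<tau>' * 0"
        using LIMSEQ_ignore_initial_segment[OF lim_1_over_n, of 2] by (intro tendsto_mult_left) simp
      then have x0: "x \<longlonglongrightarrow> 0" by (simp add: x_def[abs_def])
      define Z where "Z n = mat_exp (x n *\<^sub>R A) ** P ** (mat_exp ((\<tau>' - x n) *\<^sub>R A') ** P' ** Y')" for n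
      have "jump_word M t (Z n)" for n
      proof -
        have "jump_word M (x n + (\<tau>' - x n + t'')) (Z n)"
          unfolding Z_def using x step AP by (intro jump_word.step) auto
        moreover have "x n + (\<tau>' - x n + t'') = t" using True X step by simp
        ultimately show ?thesis by simp
      qed
      moreover have "Z \<longlonglongrightarrow> X"
      proof -
        have "(\<lambda>n. mat_exp ((- x n) *\<^sub>R A')) \<longlonglongrightarrow> mat 1"
          using tendsto_minus[OF x0] by (intro mat_exp_tendsto_one) simp
        from matrix_mult_tendsto[OF tendsto_const[of "mat_exp (\<tau>' *\<^sub>R A')"] this]
        have "(\<lambda>n. mat_exp ((\<tau>' - x n) *\<^sub>R A')) \<longlonglongrightarrow> mat_exp (\<tau>' *\<^sub>R A')"
          unfolding mat_exp_add by simp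
        then have "Z \<longlonglongrightarrow> mat 1 ** P ** (mat_exp (\<tau>' *\<^sub>R A') ** P' ** Y')"
          unfolding Z_def by (intro matrix_mult_tendsto tendsto_const mat_exp_tendsto_one x0)
        then show ?thesis using X True step by (simp add: mat_exp_zero)
      qed
      ultimately show ?thesis unfolding closure_sequential by blast
    qed
  qed
qed

text \<open>Elements at time \<open>0\<close> are the projections themselves; each is approached by
  running its mode for a vanishing time.\<close>

lemma jump_set_0_limit:
  assumes "P \<in> jump_set M 0"
  shows "\<exists>X. (\<forall>n. jump_word M (1 / real (Suc n)) (X n)) \<and> X \<longlonglongrightarrow> P"
proof -
  obtain \<tau> A Q Y t' where P: "P = mat_exp (\<tau> *\<^sub>R A) ** Q ** Y" "0 \<le> \<tau>" "0 = \<tau> + t'"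
    and AQ: "(A, Q) \<in> M" and Y: "jump_word M t' Y" using assms unfolding jump_set_eq by auto
  have "\<tau> = 0" "t' = 0" using P jump_word_nonneg[OF Y] by auto
  then have P: "P = Q" using P jump_word_0[of M Y] Y by (simp add: mat_exp_zero)
  have "(\<lambda>n. mat_exp ((1 / real (Suc n)) *\<^sub>R A) ** Q) \<longlonglongrightarrow> mat 1 ** Q"
    by (intro matrix_mult_tendsto tendsto_const mat_exp_tendsto_one LIMSEQ_Suc[OF lim_1_over_n])
  then show ?thesis using P jump_word_single[OF AQ]
    by (intro exI[of _ "\<lambda>n. mat_exp ((1 / real (Suc n)) *\<^sub>R A) ** Q"]) auto
qed

text \<open>Boundedness is assumed only for each time separately. To make it uniform up to
  \<open>b\<close>, the last segment is prolonged until time \<open>b\<close>, and the prolongation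
  is undone by an exponential that is bounded because \<open>M\<close> is.\<close>

lemma jump_word_bound:
  fixes M :: "('n::finite mat \<times> 'n mat) set"
  assumes M: "compact M" and bdd: "\<And>t. 0 \<le> t \<Longrightarrow> bounded (jump_set M t)"
  shows "\<exists>B. \<forall>t. 0 < t \<longrightarrow> t \<le> b \<longrightarrow> (\<forall>X\<in>{Y. jump_word M t Y}. opnorm X \<le> B)"
proof (cases "0 < b")
  case b: True
  obtain C where C: "0 < C" "\<And>A :: 'n mat. opnorm A \<le> C * norm A" using opnorm_le_norm by blast
  obtain D where D: "0 < D" "\<And>A :: 'n mat. norm (mat_exp A - mat 1) \<le> norm (mat 1 :: 'n mat) * (exp (D * norm A) - 1)"
    using mat_exp_near_one by blast
  obtain N where N: "0 < N" "\<And>X. X \<in> jump_set M b \<Longrightarrow> norm X \<le> N"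
    using bdd[of b] b bounded_pos by (metis less_imp_le)
  obtain m where m: "0 < m" "\<And>q. q \<in> M \<Longrightarrow> norm q \<le> m"
    using M compact_imp_bounded bounded_pos by metis
  define B where "B = norm (mat 1 :: 'n mat) * exp (D * (b * m))"
  have exp_bound: "opnorm (mat_exp A) \<le> C * B" if "norm A \<le> b * m" for A :: "'n mat"
  proof -
    have "norm (mat_exp A) \<le> norm (mat 1 :: 'n mat) + norm (mat_exp A - mat 1)"
      by (metis norm_triangle_sub)
    also have "\<dots> \<le> norm (mat 1 :: 'n mat) * exp (D * norm A)" using D(2)[of A] by (simp add: algebra_simps)
    also have "\<dots> \<le> B" unfolding B_def using D that by (intro mult_left_mono) auto
    finally have "C * norm (mat_exp A) \<le> C * B" using C by simp
    then show ?thesis using C(2)[of "mat_exp A"] by linarith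
  qed
  have "opnorm X \<le> (C * B) * (C * N)" if t: "0 < t" "t \<le> b" and X: "jump_word M t X" for t X
    using X
  proof cases
    case (step t' Y A P \<tau>)
    let ?W = "mat_exp ((b - t + \<tau>) *\<^sub>R A) ** P ** Y"
    have "jump_word M (b - t + \<tau> + t') ?W" using step t by (intro jump_word.step) auto
    then have "?W \<in> jump_set M b" using step b by (intro jump_word_in_jump_set) auto
    then have W: "opnorm ?W \<le> C * N" using N(2)[of ?W] C mult_left_mono[of "norm ?W" N C]
      by (meson less_imp_le order_trans)
    have "mat_exp ((- (b - t)) *\<^sub>R A) ** ?W = X"
      using step mat_exp_add[of "- (b - t)" A "b - t + \<tau>"] by (simp add: matrix_mul_assoc)
    then have "opnorm X \<le> opnorm (mat_exp ((- (b - t)) *\<^sub>R A)) * opnorm ?W" using opnorm_mult by metis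
    also have "\<dots> \<le> (C * B) * (C * N)"
    proof (intro mult_mono exp_bound W)
      have "norm A \<le> m" using m(2)[OF step(4)] norm_fst_le[of A P] by simp
      then show "norm ((- (b - t)) *\<^sub>R A) \<le> b * m" using t m by (simp add: mult_mono)
      show "0 \<le> C * B" using C by (simp add: B_def)
    qed (rule opnorm_nonneg)
    finally show ?thesis .
  qed (use t in auto)
  then show ?thesis by (intro exI[of _ "(C * B) * (C * N)"]) auto
qed auto

section \<open>The three kinds of semigroups\<close>

lemma hull_closure: "A \<in> convex hull C \<Longrightarrow> C \<subseteq> closure D \<Longrightarrow> A \<in> convex hull (closure D)"
  using hull_mono by blast

lemma disc_extremal_norm:
  fixes K :: "(real^'n) set"
  assumes K: "proper_cone K" and M: "compact M" and T: "T = range real"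
    and S: "\<And>k::nat. S (real k) = disc_set M k" and pos: "\<forall>t\<in>T. S t \<subseteq> pi_cone K"
    and t0: "t0 \<in> T" "0 < t0" "A \<in> convex hull (S t0)" "K_irreducible K A"
  shows "\<exists>v. is_norm v \<and> monotone_norm K v \<and> extremal_norm T S v"
proof -
  interpret cone_semigroup K T S t0 A
  proof
    show "proper_cone K" by (rule K)
    show "s + t \<in> T" if "s \<in> T" "t \<in> T" for s t
      using that unfolding T by (auto simp flip: of_nat_add)
    show "t - s \<in> T" if "s \<in> T" "t \<in> T" "s < t" for s t
      using that unfolding T by (auto simp flip: of_nat_diff)
    show "S t \<subseteq> pi_cone K" if "t \<in> T" for t using pos that by blast
    fix s t X Y assume "s \<in> T" "t \<in> T"
    then obtain k l where kl: "s = real k" "t = real l" by (auto simp: T)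
    then have st: "S (s + t) = disc_set M (k + l)" using S[of "k + l"] by simp
    show "X ** Y \<in> S (s + t)" if "X \<in> S s" "Y \<in> S t"
      using that unfolding st unfolding kl S by (rule disc_set_mult)
    show "\<exists>X\<in>S s. \<exists>Y\<in>S t. Z = X ** Y" if "Z \<in> S (s + t)" for Z
      using that unfolding st unfolding kl S by (rule disc_set_split)
  next
    fix b :: real
    obtain L where L: "1 \<le> L" "\<And>A. A \<in> M \<Longrightarrow> opnorm A \<le> L" using compact_opnorm_bound[OF M] by blast
    have "opnorm X \<le> L ^ nat \<lceil>b\<rceil>" if t: "t \<in> T" "t \<le> b" "X \<in> S t" for t X
    proof -
      obtain k where k: "t = real k" using t by (auto simp: T)
      then have "opnorm X \<le> L ^ k" using disc_set_bound[OF L] t S by blast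
      also have "\<dots> \<le> L ^ nat \<lceil>b\<rceil>" using t k by (intro power_increasing L) linarith
      finally show ?thesis .
    qed
    then show "\<exists>B. \<forall>t\<in>T. 0 < t \<longrightarrow> t \<le> b \<longrightarrow> (\<forall>X\<in>S t. opnorm X \<le> B)" by blast
  qed (use t0 hull_closure[OF _ closure_subset] in auto)
  show ?thesis
  proof (rule exists_extremal_norm)
    show "P = mat 1 \<or> (\<exists>X. (\<forall>n. 1 / real (Suc n) \<in> T \<and> X n \<in> S (1 / real (Suc n))) \<and> X \<longlonglongrightarrow> P)"
      if "P \<in> S 0" for P
      using that S[of 0] by (simp add: disc_set_def)
  qed (use closure_subset T in auto)
qed

lemma cont_extremal_norm:
  fixes K :: "(real^'n) set"
  assumes K: "proper_cone K" and M: "compact M" and T: "T = {0..}"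
    and S: "\<And>t. 0 \<le> t \<Longrightarrow> S t = cont_set M t" and pos: "\<forall>t\<in>T. S t \<subseteq> pi_cone K"
    and t0: "t0 \<in> T" "0 < t0" "A \<in> convex hull (S t0)" "K_irreducible K A"
  shows "\<exists>v. is_norm v \<and> monotone_norm K v \<and> extremal_norm T S v"
proof -
  interpret cone_semigroup K T S t0 A
  proof
    show "proper_cone K" by (rule K)
    show "S t \<subseteq> pi_cone K" if "t \<in> T" for t using pos that by blast
    fix s t :: real assume st: "0 < s" "0 < t"
    show "X ** Y \<in> S (s + t)" if "X \<in> S s" "Y \<in> S t" for X Y
      using that st cont_set_mult[of s t X M Y] by (simp add: S)
    show "\<exists>X\<in>S s. \<exists>Y\<in>S t. Z = X ** Y" if "Z \<in> S (s + t)" for Z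
      using that st cont_set_split[OF M, of s t Z] by (simp add: S)
  next
    fix b :: real
    show "\<exists>B. \<forall>t\<in>T. 0 < t \<longrightarrow> t \<le> b \<longrightarrow> (\<forall>X\<in>S t. opnorm X \<le> B)"
      using cont_set_bound[OF M, of b] S by (metis less_imp_le)
  qed (use T t0 hull_closure[OF _ closure_subset] in auto)
  show ?thesis
  proof (rule exists_extremal_norm)
    show "P = mat 1 \<or> (\<exists>X. (\<forall>n. 1 / real (Suc n) \<in> T \<and> X n \<in> S (1 / real (Suc n))) \<and> X \<longlonglongrightarrow> P)"
      if "P \<in> S 0" for P
      using that S[of 0] fundamental_0[of M 0] by (auto simp: cont_set_eq)
  qed (use closure_subset T in auto)
qed

lemma jump_extremal_norm:
  fixes K :: "(real^'n) set"
  assumes K: "proper_cone K" and M: "compact M" and T: "T = {0..}"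
    and proj: "\<forall>(A, P)\<in>M. P ** P = P \<and> A ** P = P ** A"
    and S: "\<And>t. 0 \<le> t \<Longrightarrow> S t = jump_set M t" and bdd: "\<And>t. 0 \<le> t \<Longrightarrow> bounded (S t)"
    and pos: "\<forall>t\<in>T. S t \<subseteq> pi_cone K"
    and t0: "t0 \<in> T" "0 < t0" "A \<in> convex hull (S t0)" "K_irreducible K A"
  shows "\<exists>v. is_norm v \<and> monotone_norm K v \<and> extremal_norm T S v"
proof -
  \<comment> \<open>The family \<open>S\<close> itself need not be closed under products, so the
    growth theory is applied to the words.\<close>
  define E where "E t = {Y. jump_word M t Y}" for t
  have ES: "E t \<subseteq> S t" if "0 < t" for t using that jump_word_in_jump_set by (auto simp: E_def S)
  have SE: "S t \<subseteq> closure (E t)" if "0 < t" for t using that jump_set_in_closure by (auto simp: E_def S)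
  interpret cone_semigroup K T E t0 A
  proof
    show "proper_cone K" by (rule K)
    show "E t \<subseteq> pi_cone K" if "t \<in> T" "0 < t" for t using pos ES that by blast
    show "X ** Y \<in> E (s + t)" if "X \<in> E s" "Y \<in> E t" for X Y s t
      using that jump_word_mult by (simp add: E_def)
    show "\<exists>X\<in>E s. \<exists>Y\<in>E t. Z = X ** Y" if "0 < s" "0 < t" "Z \<in> E (s + t)" for s t Z
      using that jump_word_split[OF proj, of "s + t" Z s t] by (auto simp: E_def)
    show "A \<in> convex hull (closure (E t0))" using hull_closure[OF t0(3) SE[OF t0(2)]] .
    fix b :: real
    have "\<And>t. 0 \<le> t \<Longrightarrow> bounded (jump_set M t)" using bdd S by simp
    from jump_word_bound[OF M this, of b]
    show "\<exists>B. \<forall>t\<in>T. 0 < t \<longrightarrow> t \<le> b \<longrightarrow> (\<forall>X\<in>E t. opnorm X \<le> B)"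
      unfolding E_def by blast
  qed (use T t0 in auto)
  show ?thesis
  proof (rule exists_extremal_norm)
    show "P = mat 1 \<or> (\<exists>X. (\<forall>n. 1 / real (Suc n) \<in> T \<and> X n \<in> E (1 / real (Suc n))) \<and> X \<longlonglongrightarrow> P)"
      if "P \<in> S 0" for P
      using jump_set_0_limit[of P M] that S[of 0] by (auto simp: E_def T)
  qed (use ES SE T in auto)
qed

theorem mainTheorem7:
  fixes K :: "(real^'n) set" and T :: "real set" and S :: "real \<Rightarrow> 'n mat set"
  assumes "proper_cone K"
    and "generated_semigroup T S"
    and "\<forall>t\<in>T. S t \<subseteq> pi_cone K"
    and "semigroup_K_irreducible K T S"
  shows "(\<exists>v. is_norm v \<and> monotone_norm K v \<and> extremal_norm T S v) \<and>
         (simplicial K \<longrightarrow>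
            (\<exists>v. is_norm v \<and> monotone_norm K v \<and> extremal_norm T S v \<and> absolute_norm K v))"
proof -
  interpret pcone K by unfold_locales (rule assms)
  obtain t0 A where t0: "t0 \<in> T" "0 < t0" "A \<in> convex hull (S t0)" "K_irreducible K A"
    using assms(4) by (auto simp: semigroup_K_irreducible_def)
  consider (disc) M where "compact M" "T = range real" "\<And>k::nat. S (real k) = disc_set M k"
    | (cont) M where "compact M" "T = {0..}" "\<And>t. 0 \<le> t \<Longrightarrow> S t = cont_set M t"
    | (jump) M where "compact M" "T = {0..}" "\<forall>(A, P)\<in>M. P ** P = P \<and> A ** P = P ** A"
        "\<And>t. 0 \<le> t \<Longrightarrow> S t = jump_set M t" "\<And>t. 0 \<le> t \<Longrightarrow> bounded (S t)"
    using assms(2) unfolding generated_semigroup_def by blast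
  then have ex: "\<exists>v. is_norm v \<and> monotone_norm K v \<and> extremal_norm T S v"
  proof cases
    case disc
    then show ?thesis by (intro disc_extremal_norm[OF assms(1) _ _ _ assms(3) t0])
  next
    case cont
    then show ?thesis by (intro cont_extremal_norm[OF assms(1) _ _ _ assms(3) t0])
  next
    case jump
    then show ?thesis by (intro jump_extremal_norm[OF assms(1) _ _ _ _ _ assms(3) t0])
  qed
  then obtain v where v: "is_norm v" "monotone_norm K v" "extremal_norm T S v" by blast
  show ?thesis
  proof (intro conjI impI ex)
    assume "simplicial K"
    then show "\<exists>v. is_norm v \<and> monotone_norm K v \<and> extremal_norm T S v \<and> absolute_norm K v"
      by (rule absolute_extremal_norm[OF _ assms(3) v])
  qed
qed

end
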